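(* Let $\phi_i:\mathbb{R}\to\,]-\infty,+\infty]$ be proper, lower semicontinuous and convex with $\operatorname{int}\operatorname{dom}\phi_i\neq\varnothing$ for every $i=1,2,\dots,d$. Suppose that the Fenchel conjugate $\phi_i^*$ is differentiable (everywhere) on $\mathbb{R}$ for every $i=1,2,\dots,d$. Let $\phi:E=\mathbb{R}^d\to\,]-\infty,+\infty]$ be defined by $\phi(z):=\sum_{i=1}^d\phi_i(z_i)$ for $z=(z_1,\dots,z_d)\in E$. Then $I_\phi$ is strongly rotund on $L^1_E(S,\mu)$.
   Context: $d\in\{1,2,3,\dots\}$ and $E=\mathbb{R}^d$ is Euclidean space with its Euclidean norm. $(S,\mu)$ is a complete finite measure space with $\mu\neq 0$. $L^1_E(S,\mu)$ is the Banach space of (equivalence classes of) measurable $f:S\to E$ with $\|f\|_1:=\int_S\|f(s)\|\,d\mu(s)<+\infty$; its dual is $L^\infty_E(S,\mu)$ via $\langle f,g\rangle=\int_S\langle f(s),g(s)\rangle\,d\mu(s)$. For a function $f:X\to\,]-\infty,+\infty]$ on a Banach space, $\operatorname{dom} f:=\{x: f(x)<+\infty\}$, $f$ is proper if $\operatorname{dom} f\neq\varnothing$, and $f^*(x^* ):=\sup_x(\langle x,x^*\rangle-f(x))$. The integral functional is $I_\phi:L^1_E(S,\mu)\to\,]-\infty,+\infty]$, $I_\phi(x):=\int_S\phi(x(s))\,d\mu(s)$. A proper function $f:X\to\,]-\infty,+\infty]$ is strongly rotund if (1) $f$ is strictly convex on its domain; (2) all lower level sets $\{x\in X: f(x)\le\lambda\}$,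 $\lambda\in\mathbb{R}$, are weakly compact; and (3) $f$ has the Kadec (Kadec--Klee) property: whenever a sequence $(x_n)$ converges weakly to $x\in\operatorname{dom} f$ and $f(x_n)\to f(x)$, then $x_n\to x$ in norm. *)

theory Defs
  imports "HOL-Analysis.Analysis"
begin

section \<open>Extended-real-valued functions\<close>

text \<open>A function from \<open>C\<close> to the interval from \<open>-\<infinity>\<close> (excluded) to \<open>+\<infinity>\<close> (included) is an
  \<open>ereal\<close>-valued function; that it omits the value \<open>-\<infinity>\<close> on \<open>C\<close> is part of \<open>proper_on\<close>.\<close>

definition effective_domain :: "'v set \<Rightarrow> ('v \<Rightarrow> ereal) \<Rightarrow> 'v set" where
  "effective_domain C f = {x \<in> C. f x < \<infinity>}"

definition proper_on :: "'v set \<Rightarrow> ('v \<Rightarrow> ereal) \<Rightarrow> bool" where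
  "proper_on C f \<longleftrightarrow> (\<forall>x\<in>C. f x \<noteq> -\<infinity>) \<and> effective_domain C f \<noteq> {}"

definition lower_semicontinuous :: "('v::topological_space \<Rightarrow> ereal) \<Rightarrow> bool" where
  "lower_semicontinuous f \<longleftrightarrow> (\<forall>x. \<forall>c < f x. \<forall>\<^sub>F y in nhds x. c < f y)"

definition ereal_convex :: "('v::real_vector \<Rightarrow> ereal) \<Rightarrow> bool" where
  "ereal_convex f \<longleftrightarrow> (\<forall>x y t. 0 < t \<and> t < 1 \<longrightarrow>
     f ((1 - t) *\<^sub>R x + t *\<^sub>R y) \<le> ereal (1 - t) * f x + ereal t * f y)"

definition fenchel_conjugate :: "('v::real_inner \<Rightarrow> ereal) \<Rightarrow> 'v \<Rightarrow> ereal" where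
  "fenchel_conjugate f y = (SUP x. ereal (x \<bullet> y) - f x)"

text \<open>Differentiability everywhere includes finiteness everywhere.\<close>

definition ereal_differentiable :: "('v::real_normed_vector \<Rightarrow> ereal) \<Rightarrow> bool" where
  "ereal_differentiable f \<longleftrightarrow>
     (\<forall>x. \<bar>f x\<bar> \<noteq> \<infinity>) \<and> (\<forall>x. (\<lambda>y. real_of_ereal (f y)) differentiable (at x))"


section \<open>Normed spaces on a carrier set, and strong rotundity\<close>

text \<open>The space \<open>L\<^sup>1\<close> of a measure depends on that measure and so is not a type. Normed spaces are
  therefore records with an explicit carrier; the operations are relevant only on the carrier.\<close>

record 'v normed_space =
  points :: "'v set"
  vadd :: "'v \<Rightarrow> 'v \<Rightarrow> 'v"
  vscale :: "real \<Rightarrow> 'v \<Rightarrow> 'v"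
  vnorm :: "'v \<Rightarrow> real"

text \<open>Continuous linear functionals are represented by functions on the whole type, of which only
  the restriction to the carrier matters.\<close>

definition dual_space :: "'v normed_space \<Rightarrow> ('v \<Rightarrow> real) set" where
  "dual_space X = {l.
     (\<forall>x\<in>points X. \<forall>y\<in>points X. l (vadd X x y) = l x + l y) \<and>
     (\<forall>c. \<forall>x\<in>points X. l (vscale X c x) = c * l x) \<and>
     (\<exists>B. \<forall>x\<in>points X. \<bar>l x\<bar> \<le> B * vnorm X x)}"

definition weak_topology :: "'v normed_space \<Rightarrow> 'v topology" where
  "weak_topology X =
     topology_generated_by {{x \<in> points X. l x \<in> U} | l U. l \<in> dual_space X \<and> open U}"

definition norm_converges :: "'v normed_space \<Rightarrow> (nat \<Rightarrow> 'v) \<Rightarrow> 'v \<Rightarrow> bool" where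
  "norm_converges X u x \<longleftrightarrow> (\<lambda>n. vnorm X (vadd X (u n) (vscale X (-1) x))) \<longlonglongrightarrow> 0"

definition strictly_convex_on_domain :: "'v normed_space \<Rightarrow> ('v \<Rightarrow> ereal) \<Rightarrow> bool" where
  "strictly_convex_on_domain X f \<longleftrightarrow>
     (\<forall>x\<in>effective_domain (points X) f. \<forall>y\<in>effective_domain (points X) f. \<forall>t.
        x \<noteq> y \<and> 0 < t \<and> t < 1 \<longrightarrow>
        f (vadd X (vscale X (1 - t) x) (vscale X t y)) < ereal (1 - t) * f x + ereal t * f y)"

definition kadec :: "'v normed_space \<Rightarrow> ('v \<Rightarrow> ereal) \<Rightarrow> bool" where
  "kadec X f \<longleftrightarrow>
     (\<forall>u. \<forall>x\<in>effective_domain (points X) f.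
        (\<forall>n. u n \<in> points X) \<and> limitin (weak_topology X) u x sequentially \<and>
        (\<lambda>n. f (u n)) \<longlonglongrightarrow> f x \<longrightarrow> norm_converges X u x)"

definition strongly_rotund :: "'v normed_space \<Rightarrow> ('v \<Rightarrow> ereal) \<Rightarrow> bool" where
  "strongly_rotund X f \<longleftrightarrow>
     proper_on (points X) f \<and>
     strictly_convex_on_domain X f \<and>
     (\<forall>r::real. compactin (weak_topology X) {x \<in> points X. f x \<le> ereal r}) \<and>
     kadec X f"

lemma topspace_weak_topology: "topspace (weak_topology X) = points X"
proof -
  have "(\<lambda>_. 0) \<in> dual_space X"
    by (auto simp: dual_space_def intro!: exI[of _ 0])
  then have "{x \<in> points X. (0::real) \<in> UNIV} \<in>
      {{x \<in> points X. l x \<in> U} | l U. l \<in> dual_space X \<and> open U}"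
    by (intro CollectI exI[of _ "\<lambda>_. 0"] exI[of _ UNIV]) auto
  then show ?thesis
    unfolding weak_topology_def topology_generated_by_topspace by blast
qed


section \<open>The space \<open>L\<^sup>1\<close> and integral functionals\<close>

text \<open>Points of \<open>L\<^sup>1\<close> are classes of integrable functions modulo equality almost everywhere. The
  operations act on representatives chosen by \<open>SOME\<close>; they do not depend on that choice, see
  \<open>L1_add\<close>, \<open>L1_scale\<close>, \<open>L1_norm\<close> and \<open>integral_functional_class\<close> below.\<close>

definition L1_class :: "'s measure \<Rightarrow> ('s \<Rightarrow> 'e::{banach,second_countable_topology}) \<Rightarrow> ('s \<Rightarrow> 'e) set"
  where "L1_class M f = {g. integrable M g \<and> (AE s in M. g s = f s)}"

definition L1_rep :: "('s \<Rightarrow> 'e) set \<Rightarrow> 's \<Rightarrow> 'e" where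
  "L1_rep x = (SOME f. f \<in> x)"

definition L1 :: "'s measure \<Rightarrow> ('s \<Rightarrow> 'e::{banach,second_countable_topology}) set normed_space" where
  "L1 M = \<lparr>points = {L1_class M f | f. integrable M f},
     vadd = (\<lambda>x y. L1_class M (\<lambda>s. L1_rep x s + L1_rep y s)),
     vscale = (\<lambda>c x. L1_class M (\<lambda>s. c *\<^sub>R L1_rep x s)),
     vnorm = (\<lambda>x. \<integral>s. norm (L1_rep x s) \<partial>M)\<rparr>"

text \<open>Integral of an extended-real-valued function: integral of the positive part minus that of
  the negative part, with the convention \<open>\<infinity> - \<infinity> = \<infinity>\<close> of type \<open>ereal\<close>.\<close>

definition ereal_integral :: "'s measure \<Rightarrow> ('s \<Rightarrow> ereal) \<Rightarrow> ereal" where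
  "ereal_integral M h =
     enn2ereal (\<integral>\<^sup>+ s. e2ennreal (h s) \<partial>M) - enn2ereal (\<integral>\<^sup>+ s. e2ennreal (- h s) \<partial>M)"

definition integral_functional :: "'s measure \<Rightarrow> ('e \<Rightarrow> ereal) \<Rightarrow> ('s \<Rightarrow> 'e) set \<Rightarrow> ereal" where
  "integral_functional M \<phi> x = ereal_integral M (\<lambda>s. \<phi> (L1_rep x s))"

lemma L1_class_eqI:
  assumes "AE s in M. f s = g s"
  shows "L1_class M f = L1_class M g"
  using assms unfolding L1_class_def by (auto elim!: eventually_elim2)

lemma L1_class_eq_iff:
  assumes "integrable M f"
  shows "L1_class M f = L1_class M g \<longleftrightarrow> (AE s in M. f s = g s)"
proof
  assume "L1_class M f = L1_class M g"
  moreover have "f \<in> L1_class M f" using assms by (simp add: L1_class_def)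
  ultimately show "AE s in M. f s = g s" by (auto simp: L1_class_def)
qed (rule L1_class_eqI)

lemma L1_rep_class:
  assumes "integrable M f"
  shows "integrable M (L1_rep (L1_class M f))"
    and "AE s in M. L1_rep (L1_class M f) s = f s"
proof -
  have "f \<in> L1_class M f" using assms by (simp add: L1_class_def)
  then have "L1_rep (L1_class M f) \<in> L1_class M f"
    unfolding L1_rep_def by (rule someI[where P = "\<lambda>h. h \<in> L1_class M f"])
  then show "integrable M (L1_rep (L1_class M f))"
    "AE s in M. L1_rep (L1_class M f) s = f s"
    by (auto simp: L1_class_def)
qed

lemma L1_add:
  assumes "integrable M f" "integrable M g"
  shows "vadd (L1 M) (L1_class M f) (L1_class M g) = L1_class M (\<lambda>s. f s + g s)"
  using L1_rep_class(2)[OF assms(1)] L1_rep_class(2)[OF assms(2)]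
  unfolding L1_def by (auto intro!: L1_class_eqI elim: eventually_elim2)

lemma L1_scale:
  assumes "integrable M f"
  shows "vscale (L1 M) c (L1_class M f) = L1_class M (\<lambda>s. c *\<^sub>R f s)"
  using L1_rep_class(2)[OF assms]
  unfolding L1_def by (auto intro!: L1_class_eqI elim: eventually_mono)

lemma L1_norm:
  assumes "integrable M f"
  shows "vnorm (L1 M) (L1_class M f) = (\<integral>s. norm (f s) \<partial>M)"
proof -
  have "(\<integral>s. norm (L1_rep (L1_class M f) s) \<partial>M) = (\<integral>s. norm (f s) \<partial>M)"
    using L1_rep_class[OF assms] assms
    by (intro integral_cong_AE) (auto elim: eventually_mono)
  then show ?thesis by (simp add: L1_def)
qed

lemma integral_functional_class:
  assumes "integrable M f"
  shows "integral_functional M \<phi> (L1_class M f) = ereal_integral M (\<lambda>s. \<phi> (f s))"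
proof -
  note ae = L1_rep_class(2)[OF assms]
  have "(\<integral>\<^sup>+ s. e2ennreal (\<phi> (L1_rep (L1_class M f) s)) \<partial>M) = (\<integral>\<^sup>+ s. e2ennreal (\<phi> (f s)) \<partial>M)"
    "(\<integral>\<^sup>+ s. e2ennreal (- \<phi> (L1_rep (L1_class M f) s)) \<partial>M) = (\<integral>\<^sup>+ s. e2ennreal (- \<phi> (f s)) \<partial>M)"
    using ae by (auto intro!: nn_integral_cong_AE elim: eventually_mono)
  then show ?thesis
    by (simp add: integral_functional_def ereal_integral_def)
qed

end

(*
  Finiteness of the conjugates makes each \<phi>_i superlinear, and differentiability of the conjugates makes
  it strictly convex; adding a constant makes it nonnegative. So the integral functional is, up to a
  constant, the sum over the coordinates of integrals of nonnegative functions \<psi>_i.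

  Level sets are bounded and uniformly integrable by superlinear growth. Given a filter on a level
  set, Tychonoff yields a finer filter along which the integrals of the positive and negative parts of
  all coordinates over all measurable sets converge; uniform integrability and Radon-Nikodym identify
  the limits with those of an integrable function. It lies in the level set because \<psi>_i is a
  supremum of countably many affine functions (Fenchel-Moreau).

  For the Kadec property, weak lower semicontinuity at the midpoints (x_n + x)/2 forces the integrals
  of the nonnegative gaps (\<psi>_i(x_n) + \<psi>_i(x))/2 - \<psi>_i((x_n + x)/2) to tend to 0. The gap
  grows with the distance of its arguments, so a subsequence converges almost everywhere, and Fatou's
  lemma upgrades this to convergence in norm.
*)
theory Submission
  imports Defs
begin

section \<open>Convex functions on the line and their conjugates\<close>

text \<open>L^1 is in general not reflexive, so bounded level sets need not be weakly compact:
  growth must keep mass from concentrating on small sets. Its source is Young's inequality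
  \<open>\<phi> t \<ge> q * t - k q\<close> with k the conjugate, available for every slope q of
  either sign when k is finite everywhere. Compactness is a statement about covers, hence filters
  instead of sequences. Tychonoff is applied to integrals over all measurable sets since limits of
  such set functions remain finitely additive, and uniform integrability supplies countable
  additivity. Positive and negative parts are kept apart so that these limits are nonnegative and
  thus measures. To recognise convergence on sets as weak convergence, functionals on L^1 are
  represented by bounded densities, for which the same density lemma serves. The separable form
  reduces the Kadec property to the line: convergence of the sum forces that of each coordinate
  integral, as every one is lower semicontinuous, and only two points lie at distance e from a real
  number, so strict convexity alone keeps the midpoint gap away from 0 there.\<close>

lemma fenchel_conjugate_minorant:
  fixes \<phi> :: "real \<Rightarrow> ereal"
  assumes "\<bar>fenchel_conjugate \<phi> q\<bar> \<noteq> \<infinity>"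
  shows "ereal (q * t - real_of_ereal (fenchel_conjugate \<phi> q)) \<le> \<phi> t"
proof -
  obtain k where k: "fenchel_conjugate \<phi> q = ereal k" using assms by auto
  have "ereal (t \<bullet> q) - \<phi> t \<le> ereal k"
    unfolding k[symmetric] fenchel_conjugate_def by (rule SUP_upper) simp
  then show ?thesis unfolding k
    by (cases "\<phi> t") (auto simp: mult.commute)
qed

lemma fenchel_conjugate_le:
  fixes \<phi> :: "real \<Rightarrow> ereal"
  assumes "\<And>t. ereal (q * t - k) \<le> \<phi> t"
  shows "fenchel_conjugate \<phi> q \<le> ereal k"
  unfolding fenchel_conjugate_def
proof (rule SUP_least)
  fix t show "ereal (t \<bullet> q) - \<phi> t \<le> ereal k"
    using assms[of t] by (cases "\<phi> t") (auto simp: mult.commute)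
qed

lemma closed_epigraph:
  fixes \<phi> :: "real \<Rightarrow> ereal"
  assumes "lower_semicontinuous \<phi>"
  shows "closed {(z, r). \<phi> z \<le> ereal r}"
  unfolding closed_sequential_limits
proof safe
  fix X z r assume X: "\<forall>n. X n \<in> {(z, r). \<phi> z \<le> ereal r}" and lim: "X \<longlonglongrightarrow> (z, r)"
  show "\<phi> z \<le> ereal r"
  proof (rule ccontr)
    assume "\<not> \<phi> z \<le> ereal r"
    then obtain c where c: "ereal r < c" "c < \<phi> z" using dense by (metis not_le)
    have lz: "(\<lambda>n. fst (X n)) \<longlonglongrightarrow> z" and lr: "(\<lambda>n. snd (X n)) \<longlonglongrightarrow> r"
      using tendsto_fst[OF lim] tendsto_snd[OF lim] by auto
    have "\<forall>\<^sub>F n in sequentially. c < \<phi> (fst (X n))"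
      using assms c(2) lz unfolding lower_semicontinuous_def filterlim_iff by blast
    moreover have "\<forall>\<^sub>F n in sequentially. ereal (snd (X n)) < c"
      using order_tendstoD(2)[OF tendsto_ereal[OF lr] c(1)] .
    ultimately have "\<forall>\<^sub>F n in sequentially. False"
    proof eventually_elim
      case (elim n)
      then show ?case using X[rule_format, of n] by (auto simp: case_prod_beta)
    qed
    then show False by simp
  qed
qed

lemma convex_epigraph:
  fixes \<phi> :: "real \<Rightarrow> ereal"
  assumes "ereal_convex \<phi>"
  shows "convex {(z, r). \<phi> z \<le> ereal r}"
  unfolding convex_alt
proof (intro ballI allI impI)
  fix x y :: "real \<times> real" and u :: real
  assume x: "x \<in> {(z, r). \<phi> z \<le> ereal r}" and y: "y \<in> {(z, r). \<phi> z \<le> ereal r}"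
    and u: "0 \<le> u \<and> u \<le> 1"
  obtain z r z' r' where eq: "x = (z, r)" "y = (z', r')" by (cases x, cases y)
  have le: "\<phi> z \<le> ereal r" "\<phi> z' \<le> ereal r'" using x y by (auto simp: eq)
  consider "u = 0" | "u = 1" | "0 < u" "u < 1" using u by fastforce
  then show "(1 - u) *\<^sub>R x + u *\<^sub>R y \<in> {(z, r). \<phi> z \<le> ereal r}"
  proof cases
    case 3
    have "\<phi> ((1 - u) *\<^sub>R z + u *\<^sub>R z') \<le> ereal (1 - u) * \<phi> z + ereal u * \<phi> z'"
      using assms 3 unfolding ereal_convex_def by blast
    also have "\<dots> \<le> ereal (1 - u) * ereal r + ereal u * ereal r'"
      using 3 le by (intro add_mono ereal_mult_left_mono) auto
    finally show ?thesis by (simp add: eq)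
  qed (use x y in auto)
qed

text \<open>A line separating (t, v) from the closed convex epigraph is, if not vertical, an affine
  minorant passing above v at t. A vertical one only separates t from the domain; a large multiple
  of it is then added to the constant minorant that the finite conjugate at 0 provides.\<close>

lemma fenchel_moreau_real:
  fixes \<phi> :: "real \<Rightarrow> ereal"
  assumes "proper_on UNIV \<phi>" "lower_semicontinuous \<phi>" "ereal_convex \<phi>"
    and fin: "\<And>q. \<bar>fenchel_conjugate \<phi> q\<bar> \<noteq> \<infinity>"
    and v: "ereal v < \<phi> t"
  shows "\<exists>q. v < q * t - real_of_ereal (fenchel_conjugate \<phi> q)"
proof -
  define k where "k q = real_of_ereal (fenchel_conjugate \<phi> q)" for q
  have kle: "k q \<le> c" if "\<And>z. ereal (q * z - c) \<le> \<phi> z" for q c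
    using fenchel_conjugate_le[OF that] fin[of q]
    by (cases "fenchel_conjugate \<phi> q") (auto simp: k_def)
  have nmi: "\<phi> z \<noteq> -\<infinity>" for z using assms(1) by (auto simp: proper_on_def)
  have "\<exists>p g. p \<bullet> (t, v) < g \<and> (\<forall>x\<in>{(z, r). \<phi> z \<le> ereal r}. p \<bullet> x > g)"
    by (rule separating_hyperplane_closed_point)
      (use v closed_epigraph[OF assms(2)] convex_epigraph[OF assms(3)] in auto)
  then obtain \<alpha> \<beta> \<gamma> where sep: "\<alpha> * t + \<beta> * v < \<gamma>"
      "\<And>z r. \<phi> z \<le> ereal r \<Longrightarrow> \<gamma> < \<alpha> * z + \<beta> * r"
    by fastforce
  obtain z0 where "\<phi> z0 < \<infinity>" using assms(1) by (auto simp: proper_on_def effective_domain_def)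
  then obtain r0 where r0: "\<phi> z0 = ereal r0" using nmi[of z0] by (cases "\<phi> z0") auto
  have "\<beta> \<ge> 0"
  proof (rule ccontr)
    assume n: "\<not> \<beta> \<ge> 0"
    \<comment> \<open>The epigraph contains the whole ray above (z0, r0). For negative \<beta> the
      separating functional falls along it, and at this height it is no longer above
      \<gamma>.\<close>
    define r where "r = max r0 ((\<gamma> - \<alpha> * z0) / \<beta>)"
    have "\<gamma> < \<alpha> * z0 + \<beta> * r" by (rule sep(2)) (simp add: r0 r_def)
    moreover have "\<beta> * r \<le> \<beta> * ((\<gamma> - \<alpha> * z0) / \<beta>)" using n
      by (intro mult_left_mono_neg) (auto simp: r_def)
    ultimately show False using n by simp
  qed
  then consider "\<beta> > 0" | "\<beta> = 0" by fastforce
  then show ?thesis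
  proof cases
    case 1
    \<comment> \<open>Solving the separating inequality for the second coordinate gives the minorant
      of slope \<open>- \<alpha> / \<beta>\<close> and value \<open>\<gamma> / \<beta>\<close> at
      0.\<close>
    have "k (- \<alpha> / \<beta>) \<le> - \<gamma> / \<beta>"
    proof (rule kle)
      fix z show "ereal (- \<alpha> / \<beta> * z - - \<gamma> / \<beta>) \<le> \<phi> z"
        using nmi[of z] sep(2)[of z "real_of_ereal (\<phi> z)"] 1
        by (cases "\<phi> z") (auto simp: field_simps)
    qed
    moreover have "v < - \<alpha> / \<beta> * t - (- \<gamma> / \<beta>)" using sep(1) 1 by (simp add: field_simps)
    ultimately show ?thesis unfolding k_def by (intro exI[of _ "- \<alpha> / \<beta>"]) linarith
  next
    case 2
    \<comment> \<open>Now \<open>\<gamma> - \<alpha> * z\<close> is at most 0 on the domain and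
      positive at t. Adding n times it to the minorant \<open>- k 0\<close> keeps a minorant if n is
      nonnegative, and passes above v at t if n exceeds the quotient.\<close>
    define n where "n = max 0 ((v + k 0) / (\<gamma> - \<alpha> * t)) + 1"
    have pos: "\<gamma> - \<alpha> * t > 0" using sep(1) 2 by simp
    have "(v + k 0) / (\<gamma> - \<alpha> * t) < n" by (simp add: n_def)
    then have n: "v + k 0 < n * (\<gamma> - \<alpha> * t)" using pos by (simp add: field_simps)
    have "k (- n * \<alpha>) \<le> k 0 - n * \<gamma>"
    proof (rule kle)
      fix z
      show "ereal (- n * \<alpha> * z - (k 0 - n * \<gamma>)) \<le> \<phi> z"
      proof (cases "\<phi> z")
        case (real r)
        have "\<gamma> \<le> \<alpha> * z" using sep(2)[of z r] real 2 by simp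
        then have "n * \<gamma> \<le> n * (\<alpha> * z)" by (intro mult_left_mono) (auto simp: n_def)
        moreover have "- k 0 \<le> r" using fenchel_conjugate_minorant[OF fin, of 0 z] real by (simp add: k_def)
        ultimately show ?thesis using real by (simp add: algebra_simps)
      qed (use nmi in auto)
    qed
    then show ?thesis using n unfolding k_def
      by (intro exI[of _ "- n * \<alpha>"]) (simp add: algebra_simps)
  qed
qed

text \<open>An affine piece of \<open>\<phi>\<close> would force two different slopes of \<open>\<phi>\<^sup>*\<close> at its slope.\<close>

lemma strictly_convex_if_conjugate_differentiable:
  fixes \<phi> :: "real \<Rightarrow> ereal"
  assumes "proper_on UNIV \<phi>" "ereal_convex \<phi>" "ereal_differentiable (fenchel_conjugate \<phi>)"
    and "\<phi> x < \<infinity>" "\<phi> y < \<infinity>" "x \<noteq> y" "0 < t" "t < 1"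
  shows "\<phi> ((1 - t) * x + t * y) < ereal (1 - t) * \<phi> x + ereal t * \<phi> y"
proof (rule ccontr)
  assume nlt: "\<not> ?thesis"
  have fin: "\<bar>fenchel_conjugate \<phi> q\<bar> \<noteq> \<infinity>" for q
    using assms(3) by (auto simp: ereal_differentiable_def)
  define k where "k q = real_of_ereal (fenchel_conjugate \<phi> q)" for q
  define R where "R z = real_of_ereal (\<phi> z)" for z
  define I where "I = {z. \<phi> z < \<infinity>}"
  define m where "m = (1 - t) * x + t * y"
  have nmi: "\<phi> z \<noteq> -\<infinity>" for z using assms(1) by (auto simp: proper_on_def)
  have RI: "\<phi> z = ereal (R z)" if "z \<in> I" for z
    using that nmi[of z] by (cases "\<phi> z") (auto simp: R_def I_def)
  have cvx: "(1 - s) * u + s * w \<in> I \<and> R ((1 - s) * u + s * w) \<le> (1 - s) * R u + s * R w"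
    if "u \<in> I" "w \<in> I" "0 < s" "s < 1" for u w s
  proof -
    have "\<phi> ((1 - s) * u + s * w) \<le> ereal (1 - s) * \<phi> u + ereal s * \<phi> w"
      using assms(2) that(3,4) unfolding ereal_convex_def real_scaleR_def by blast
    then have le: "\<phi> ((1 - s) * u + s * w) \<le> ereal ((1 - s) * R u + s * R w)"
      using RI[OF that(1)] RI[OF that(2)] by simp
    moreover from le have "(1 - s) * u + s * w \<in> I"
      unfolding I_def by (metis (no_types, lifting) PInfty_neq_ereal(1) ereal_infty_less(1) ereal_infty_less_eq(1) mem_Collect_eq)
    ultimately show ?thesis using RI by auto
  qed
  have convI: "convex I"
    unfolding convex_alt
  proof (intro ballI allI impI)
    fix u w s :: real assume *: "u \<in> I" "w \<in> I" "0 \<le> s \<and> s \<le> 1"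
    consider "s = 0" | "s = 1" | "0 < s" "s < 1" using * by fastforce
    then show "(1 - s) *\<^sub>R u + s *\<^sub>R w \<in> I" using cvx[OF *(1,2)] * by cases auto
  qed
  have convR: "convex_on I R"
    using convI
  proof (rule convex_onI[rotated])
    fix s u w :: real assume "0 < s" "s < 1" "u \<in> I" "w \<in> I"
    then show "R ((1 - s) *\<^sub>R u + s *\<^sub>R w) \<le> (1 - s) * R u + s * R w" using cvx by simp
  qed
  have xy: "x \<in> I" "y \<in> I" using assms by (auto simp: I_def)
  have mI: "m \<in> I" using cvx[OF xy assms(7,8)] by (simp add: m_def)
  have "R m \<ge> (1 - t) * R x + t * R y"
    using nlt RI[OF mI] RI[OF xy(1)] RI[OF xy(2)] by (simp add: m_def[symmetric])
  \<comment> \<open>A real subgradient is guaranteed only at interior points of the domain; m is one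
    because it lies strictly between x and y.\<close>
  moreover have "m \<in> interior I"
  proof -
    have "{min x y<..<max x y} \<subseteq> I"
    proof -
      have "closed_segment x y \<subseteq> I" using convI xy by (simp add: closed_segment_subset)
      then show ?thesis by (auto simp: closed_segment_eq_real_ivl split: if_splits)
    qed
    moreover have "m \<in> {min x y<..<max x y}"
    proof (cases "x < y")
      case True
      have "t * x < t * y" "(1 - t) * x < (1 - t) * y" using assms True by auto
      then show ?thesis using True by (auto simp: m_def algebra_simps)
    next
      case False
      then have "y < x" using assms by simp
      then have "t * y < t * x" "(1 - t) * y < (1 - t) * x" using assms by auto
      then show ?thesis using \<open>y < x\<close> by (auto simp: m_def algebra_simps)
    qed
    ultimately show ?thesis by (meson interiorI open_greaterThanLessThan)
  qed
  then obtain p where p: "\<And>z. z \<in> I \<Longrightarrow> R z \<ge> R m + p * (z - m)"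
    using convex_le_Inf_differential[OF convR] by blast
  have km: "k p \<le> p * m - R m"
  proof -
    have "fenchel_conjugate \<phi> p \<le> ereal (p * m - R m)"
    proof (rule fenchel_conjugate_le)
      fix z show "ereal (p * z - (p * m - R m)) \<le> \<phi> z"
        using p[of z] RI[of z] by (cases "z \<in> I") (auto simp: algebra_simps I_def)
    qed
    then show ?thesis using fin[of p] by (cases "fenchel_conjugate \<phi> p") (auto simp: k_def)
  qed
  have kge: "q * z - R z \<le> k q" if "z \<in> I" for q z
    using fenchel_conjugate_minorant[OF fin, of q z] RI[OF that] by (simp add: k_def)
  have px: "R x \<ge> R m + p * (x - m)" and py: "R y \<ge> R m + p * (y - m)" using p xy by auto
  \<comment> \<open>The two defects above the tangent line are nonnegative and their weighted sum is
    not positive, so the tangent line at m touches the graph at x and at y as well.\<close>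
  have s0: "(1 - t) * (R x - R m - p * (x - m)) + t * (R y - R m - p * (y - m)) \<le> 0"
    using \<open>R m \<ge> _\<close> by (simp add: m_def algebra_simps)
  have n1: "0 \<le> (1 - t) * (R x - R m - p * (x - m))" and n2: "0 \<le> t * (R y - R m - p * (y - m))"
    using px py assms by auto
  have "(1 - t) * (R x - R m - p * (x - m)) = 0" "t * (R y - R m - p * (y - m)) = 0"
    using s0 n1 n2 by linarith+
  then have ex: "R x = R m + p * (x - m)" and ey: "R y = R m + p * (y - m)" using assms by auto
  obtain D where D: "(k has_field_derivative D) (at p)"
    using assms(3) unfolding ereal_differentiable_def k_def[abs_def, symmetric]
    by (metis real_differentiable_def)
  \<comment> \<open>By Young's inequality, \<open>k q - (q * z - R z)\<close> is smallest at
    \<open>q = p\<close> for every z where the tangent line touches. Its derivative there must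
    vanish, which makes z the derivative of k at p.\<close>
  have slope: "D = z" if "z \<in> I" "R z = R m + p * (z - m)" for z
  proof -
    have "((\<lambda>q. k q - (q * z - R z)) has_field_derivative D - z) (at p)"
      by (auto intro!: derivative_eq_intros D)
    moreover have "k p - (p * z - R z) \<le> k q - (q * z - R z)" for q
      using kge[OF that(1), of q] km that(2) by (simp add: algebra_simps)
    ultimately have "D - z = 0" using DERIV_local_min[of _ "D - z" p 1] by auto
    then show ?thesis by simp
  qed
  show False using slope[OF xy(1) ex] slope[OF xy(2) ey] assms(6) by simp
qed


section \<open>Superlinear strictly convex integrands\<close>

text \<open>Values in \<open>ennreal\<close> make all integrals meaningful.
  \<open>affine_sup\<close> encodes closed convexity of a nonnegative function;
  \<open>ennreal\<close> cuts each affine function off at 0. Countability of the family yields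
  measurability and access to monotone convergence.\<close>

locale superlinear_strictly_convex =
  fixes \<psi> :: "real \<Rightarrow> ennreal"
  assumes affine_sup: "\<exists>a b :: nat \<Rightarrow> real. \<forall>t. \<psi> t = (SUP n. ennreal (a n * t + b n))"
    and strictly_convex: "\<And>x y t. \<psi> x < \<infinity> \<Longrightarrow> \<psi> y < \<infinity> \<Longrightarrow> x \<noteq> y \<Longrightarrow> 0 < t \<Longrightarrow> t < 1 \<Longrightarrow>
      \<psi> ((1 - t) * x + t * y) < ennreal (1 - t) * \<psi> x + ennreal t * \<psi> y"
    and superlinear: "\<And>q. \<exists>c\<ge>0. \<forall>t. ennreal (q * \<bar>t\<bar>) \<le> ennreal c + \<psi> t"
    and finite_somewhere: "\<exists>t. \<psi> t < \<infinity>"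

text \<open>The conjugate at 0 bounds \<phi> from below, which fixes the constant. Differentiability
  of the conjugate is used twice: for strict convexity, and as continuity, which lets rational
  slopes exhaust the Fenchel-Moreau supremum.\<close>

lemma superlinear_strictly_convex_shift:
  fixes \<phi> :: "real \<Rightarrow> ereal"
  assumes "proper_on UNIV \<phi>" "lower_semicontinuous \<phi>" "ereal_convex \<phi>"
    and "ereal_differentiable (fenchel_conjugate \<phi>)"
  shows "\<exists>c \<psi>. c \<ge> 0 \<and> superlinear_strictly_convex \<psi> \<and> (\<forall>t. \<phi> t = enn2ereal (\<psi> t) - ereal c)"
proof -
  have fin: "\<bar>fenchel_conjugate \<phi> q\<bar> \<noteq> \<infinity>" for q
    using assms(4) by (auto simp: ereal_differentiable_def)
  define k where "k q = real_of_ereal (fenchel_conjugate \<phi> q)" for q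
  have cont: "isCont k q" for q
    using assms(4) unfolding ereal_differentiable_def k_def[abs_def, symmetric]
    by (auto intro: differentiable_imp_continuous_within)
  have minor: "ereal (q * t - k q) \<le> \<phi> t" for q t
    using fenchel_conjugate_minorant[OF fin] by (simp add: k_def)
  define c where "c = max 0 (k 0)"
  define \<psi> where "\<psi> t = e2ennreal (\<phi> t + ereal c)" for t
  have c0: "0 \<le> c" and kc: "k 0 \<le> c" by (simp_all add: c_def)
  have nn: "0 \<le> \<phi> t + ereal c" for t
    using minor[of 0 t] kc by (cases "\<phi> t") auto
  have \<psi>: "enn2ereal (\<psi> t) = \<phi> t + ereal c" for t
    using nn by (simp add: \<psi>_def enn2ereal_e2ennreal)
  have \<phi>: "\<phi> t = enn2ereal (\<psi> t) - ereal c" for t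
    unfolding \<psi> by (cases "\<phi> t") auto
  have \<psi>fin: "\<psi> t < \<infinity> \<longleftrightarrow> \<phi> t < \<infinity>" for t
  proof -
    have "\<psi> t < \<infinity> \<longleftrightarrow> enn2ereal (\<psi> t) < \<infinity>"
      by (simp add: less_ennreal.rep_eq)
    then show ?thesis unfolding \<psi> by (cases "\<phi> t") auto
  qed
  have "superlinear_strictly_convex \<psi>"
  proof
    define r where "r = (from_nat_into \<rat> :: nat \<Rightarrow> real)"
    have r: "range r = \<rat>" unfolding r_def
      by (rule range_from_nat_into) (auto simp: countable_rat)
    have "\<psi> t = (SUP n. ennreal (r n * t + (c - k (r n))))" for t
    proof (rule antisym)
      show "(SUP n. ennreal (r n * t + (c - k (r n)))) \<le> \<psi> t"
      proof (rule SUP_least)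
        fix n
        have "ereal (r n * t + (c - k (r n))) \<le> \<phi> t + ereal c"
          using minor[of "r n" t] by (cases "\<phi> t") auto
        then have "e2ennreal (ereal (r n * t + (c - k (r n)))) \<le> \<psi> t"
          unfolding \<psi>_def by (rule e2ennreal_mono)
        then show "ennreal (r n * t + (c - k (r n))) \<le> \<psi> t" by simp
      qed
      show "\<psi> t \<le> (SUP n. ennreal (r n * t + (c - k (r n))))"
      proof (rule dense_le)
        fix y assume y: "y < \<psi> t"
        then obtain v where v: "y = ennreal v" "0 \<le> v" by (cases y) auto
        have "ereal v < \<phi> t + ereal c"
          using y v unfolding \<psi>[symmetric] less_ennreal.rep_eq by (simp add: enn2ereal_ennreal)
        then have "ereal (v - c) < \<phi> t" by (cases "\<phi> t") auto
        then obtain q where q: "v - c < q * t - k q"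
          using fenchel_moreau_real[OF assms(1-3) fin] by (auto simp: k_def)
        \<comment> \<open>The slope found need not be rational. By continuity of k, all slopes close
          to it also exceed \<open>v - c\<close> at t, and a rational one is among them.\<close>
        have "isCont (\<lambda>q. q * t - k q) q" by (intro continuous_intros cont)
        then have "\<forall>\<^sub>F p in at q. v - c < p * t - k p"
          using order_tendstoD(1)[OF _ q] by (simp add: isCont_def)
        then obtain d where d: "d > 0" "\<And>p. p \<noteq> q \<Longrightarrow> dist p q < d \<Longrightarrow> v - c < p * t - k p"
          by (auto simp: eventually_at)
        obtain p where p: "p \<in> \<rat>" "q < p" "p < q + d"
          using Rats_dense_in_real[of q "q + d"] d(1) by auto
        then obtain n where n: "p = r n" using r by (metis rangeE)
        have "v < r n * t + (c - k (r n))" using d(2)[of p] p n by (auto simp: dist_real_def)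
        then have "y \<le> ennreal (r n * t + (c - k (r n)))"
          unfolding v by (intro ennreal_leI) simp
        then show "y \<le> (SUP n. ennreal (r n * t + (c - k (r n))))"
          by (rule SUP_upper2[rotated]) simp
      qed
    qed
    then show "\<exists>a b :: nat \<Rightarrow> real. \<forall>t. \<psi> t = (SUP n. ennreal (a n * t + b n))"
      by (intro exI[of _ r] exI[of _ "\<lambda>n. c - k (r n)"]) blast
  next
    fix x y t :: real
    assume *: "\<psi> x < \<infinity>" "\<psi> y < \<infinity>" "x \<noteq> y" "0 < t" "t < 1"
    have lt: "\<phi> ((1 - t) * x + t * y) < ereal (1 - t) * \<phi> x + ereal t * \<phi> y"
      using strictly_convex_if_conjugate_differentiable[OF assms(1,3,4)] * \<psi>fin by simp
    obtain X where X: "\<phi> x = ereal X" using * \<psi>fin nn[of x] by (cases "\<phi> x") auto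
    obtain Y where Y: "\<phi> y = ereal Y" using * \<psi>fin nn[of y] by (cases "\<phi> y") auto
    have "enn2ereal (\<psi> ((1 - t) * x + t * y)) < ereal ((1 - t) * (X + c) + t * (Y + c))"
      using lt unfolding \<psi> X Y
      by (cases "\<phi> ((1 - t) * x + t * y)") (auto simp: algebra_simps)
    moreover have "ennreal (1 - t) * \<psi> x + ennreal t * \<psi> y = ennreal ((1 - t) * (X + c) + t * (Y + c))"
      using nn[of x] nn[of y] *(4,5) unfolding \<psi>_def X Y
      by (simp add: ennreal_plus ennreal_mult)
    moreover have "0 \<le> (1 - t) * (X + c) + t * (Y + c)"
      using nn[of x] nn[of y] *(4,5) unfolding X Y by simp
    ultimately show "\<psi> ((1 - t) * x + t * y) < ennreal (1 - t) * \<psi> x + ennreal t * \<psi> y"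
      by (simp add: less_ennreal.rep_eq enn2ereal_ennreal)
  next
    fix q :: real
    \<comment> \<open>The absolute value in the growth condition needs the minorants of both slopes
      q and -q; the maximum with 0 makes the constant nonnegative.\<close>
    define d where "d = max 0 (max (k q) (k (- q)))"
    have "ennreal (q * \<bar>t\<bar>) \<le> ennreal d + \<psi> t" for t
    proof (cases "\<phi> t")
      case (real r)
      have "q * \<bar>t\<bar> \<le> d + (r + c)"
        using minor[of q t] minor[of "- q" t] real c0 by (auto simp: d_def abs_if)
      then have "ennreal (q * \<bar>t\<bar>) \<le> ennreal (d + (r + c))" by (rule ennreal_leI)
      also have "\<dots> = ennreal d + \<psi> t"
        unfolding \<psi>_def real using nn[of t] real by (simp add: ennreal_plus d_def)
      finally show ?thesis .
    next
      case PInf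
      then show ?thesis by (simp add: \<psi>_def)
    next
      case MInf
      then show ?thesis using nn[of t] by simp
    qed
    then show "\<exists>c\<ge>0. \<forall>t. ennreal (q * \<bar>t\<bar>) \<le> ennreal c + \<psi> t"
      by (intro exI[of _ d]) (auto simp: d_def)
  next
    show "\<exists>t. \<psi> t < \<infinity>"
      unfolding \<psi>fin using assms(1) by (auto simp: proper_on_def effective_domain_def)
  qed
  then show ?thesis using c0 \<phi> by blast
qed

context superlinear_strictly_convex
begin

lemma measurable_integrand [measurable]: "\<psi> \<in> borel_measurable borel"
proof -
  obtain a b :: "nat \<Rightarrow> real" where "\<And>t. \<psi> t = (SUP n. ennreal (a n * t + b n))"
    using affine_sup by blast
  then have "\<psi> = (\<lambda>t. SUP n. ennreal (a n * t + b n))" by blast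
  then show ?thesis by simp
qed

lemma integrand_liminf:
  assumes "x \<longlonglongrightarrow> t"
  shows "\<psi> t \<le> liminf (\<lambda>n. \<psi> (x n))"
proof -
  obtain a b :: "nat \<Rightarrow> real" where ab: "\<And>t. \<psi> t = (SUP n. ennreal (a n * t + b n))"
    using affine_sup by blast
  have "ennreal (a n * t + b n) \<le> liminf (\<lambda>k. \<psi> (x k))" for n
  proof -
    have "(\<lambda>k. ennreal (a n * x k + b n)) \<longlonglongrightarrow> ennreal (a n * t + b n)"
      by (intro tendsto_ennrealI tendsto_intros assms)
    then have "ennreal (a n * t + b n) = liminf (\<lambda>k. ennreal (a n * x k + b n))"
      by (simp add: lim_imp_Liminf)
    also have "\<dots> \<le> liminf (\<lambda>k. \<psi> (x k))"
      by (intro Liminf_mono always_eventually allI) (auto simp: ab intro: SUP_upper)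
    finally show ?thesis .
  qed
  then show ?thesis unfolding ab[of t] by (intro SUP_least)
qed

text \<open>The locale gives the inequality at distinct points of finite value only. Elsewhere it is
  an equality or has an infinite right-hand side.\<close>

lemma convex:
  assumes "0 \<le> t" "t \<le> 1"
  shows "\<psi> ((1 - t) * x + t * y) \<le> ennreal (1 - t) * \<psi> x + ennreal t * \<psi> y"
proof -
  consider "t = 0" | "t = 1" | "x = y" | "\<psi> x = \<infinity>" "0 < t" "t < 1" | "\<psi> y = \<infinity>" "0 < t" "t < 1"
    | "\<psi> x < \<infinity>" "\<psi> y < \<infinity>" "x \<noteq> y" "0 < t" "t < 1"
    using assms by (metis infinity_ennreal_def less_eq_real_def top.not_eq_extremum)
  then show ?thesis
  proof cases
    case 3
    have "ennreal (1 - t) * \<psi> y + ennreal t * \<psi> y = ennreal ((1 - t) + t) * \<psi> y"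
      using assms by (subst ennreal_plus) (auto simp: distrib_right)
    then show ?thesis using 3 by (simp add: algebra_simps)
  next
    case 4
    then show ?thesis by (simp add: ennreal_mult_top)
  next
    case 5
    then show ?thesis by (simp add: ennreal_mult_top)
  next
    case 6
    then show ?thesis using strictly_convex[of x y t] by (simp add: less_imp_le)
  qed simp_all
qed

lemma convex_real:
  assumes "\<psi> x < \<infinity>" "\<psi> y < \<infinity>" "0 \<le> t" "t \<le> 1"
  shows "\<psi> ((1 - t) * x + t * y) < \<infinity>"
    and "enn2real (\<psi> ((1 - t) * x + t * y)) \<le> (1 - t) * enn2real (\<psi> x) + t * enn2real (\<psi> y)"
proof -
  obtain X where X: "\<psi> x = ennreal X" "0 \<le> X" using assms by (cases "\<psi> x") auto
  obtain Y where Y: "\<psi> y = ennreal Y" "0 \<le> Y" using assms by (cases "\<psi> y") auto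
  have *: "\<psi> ((1 - t) * x + t * y) \<le> ennreal ((1 - t) * X + t * Y)"
    using convex[OF assms(3,4), of x y] X Y assms by (simp add: ennreal_plus ennreal_mult)
  then show "\<psi> ((1 - t) * x + t * y) < \<infinity>"
    using order_le_less_trans by fastforce
  show "enn2real (\<psi> ((1 - t) * x + t * y)) \<le> (1 - t) * enn2real (\<psi> x) + t * enn2real (\<psi> y)"
    using * X Y assms by (simp add: enn2real_leI)
qed

text \<open>Real-valued, so that it can be subtracted and integrated. As \<open>enn2real\<close>
  sends \<infinity> to 0, the formula is the convexity defect only where \<psi> is finite at both
  arguments.\<close>

definition midpoint_gap :: "real \<Rightarrow> real \<Rightarrow> real" where
  "midpoint_gap x y = (enn2real (\<psi> x) + enn2real (\<psi> y)) / 2 - enn2real (\<psi> ((x + y) / 2))"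

lemma midpoint_gap_nonneg:
  assumes "\<psi> x < \<infinity>" "\<psi> y < \<infinity>"
  shows "0 \<le> midpoint_gap x y"
  using convex_real(2)[OF assms, of "1/2"] by (simp add: midpoint_gap_def field_simps)

lemma midpoint_gap_pos:
  assumes "\<psi> x < \<infinity>" "\<psi> y < \<infinity>" "x \<noteq> y"
  shows "0 < midpoint_gap x y"
proof -
  obtain X where X: "\<psi> x = ennreal X" "0 \<le> X" using assms by (cases "\<psi> x") auto
  obtain Y where Y: "\<psi> y = ennreal Y" "0 \<le> Y" using assms by (cases "\<psi> y") auto
  have "\<psi> ((x + y) / 2) < ennreal (1/2) * ennreal X + ennreal (1/2) * ennreal Y"
    using strictly_convex[OF assms, of "1/2"] X Y by (simp add: field_simps)
  also have "\<dots> = ennreal ((X + Y) / 2)"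
  proof -
    have "ennreal (1/2) * ennreal Z = ennreal (Z / 2)" if "0 \<le> Z" for Z
      using that by (subst ennreal_mult[symmetric]) auto
    then show ?thesis using X Y by (simp add: ennreal_plus[symmetric] add_divide_distrib del: ennreal_plus)
  qed
  finally have "\<psi> ((x + y) / 2) < ennreal ((X + Y) / 2)" .
  then have "enn2real (\<psi> ((x + y) / 2)) < (X + Y) / 2"
    by (cases "\<psi> ((x + y) / 2)") (auto simp: ennreal_less_iff)
  then show ?thesis using X Y by (simp add: midpoint_gap_def)
qed

text \<open>With g the restriction of \<psi> to the line, parametrised by 0 at x and 1 at y, the
  claim is \<open>g s + 2 * g (1/2) \<le> 2 * g (s/2) + g 1\<close>. It holds because s and 1/2 both
  lie between s/2 and 1, with weights that add up to the right-hand side.\<close>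

lemma midpoint_gap_mono:
  assumes fin: "\<psi> x < \<infinity>" "\<psi> y < \<infinity>" and s: "0 < s" "s \<le> 1"
  shows "midpoint_gap x (x + s * (y - x)) \<le> midpoint_gap x y"
proof -
  define g where "g t = enn2real (\<psi> (x + t * (y - x)))" for t
  have p: "x + t * (y - x) = (1 - t) * x + t * y" for t by (simp add: algebra_simps)
  have f: "\<psi> (x + t * (y - x)) < \<infinity>" if "0 \<le> t" "t \<le> 1" for t
    unfolding p by (rule convex_real(1)[OF fin that])
  have "\<psi> (x + (s/2) * (y - x)) < \<infinity>" using f[of "s/2"] s by simp
  note c = convex_real(2)[OF this fin(2)]
  have on_line: "(1 - r) * (x + s / 2 * (y - x)) + r * y = x + ((1 - r) * (s / 2) + r) * (y - x)" for r
    by (simp add: algebra_simps)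
  have cg: "g t \<le> (1 - r) * g (s / 2) + r * g 1"
    if "0 \<le> r" "r \<le> 1" "r * (2 - s) = 2 * t - s" for r t
  proof -
    have "(1 - r) * (s / 2) + r = t" using that(3) by (simp add: field_simps)
    then show ?thesis using c[OF that(1,2)] unfolding on_line g_def by simp
  qed
  \<comment> \<open>The weight of the endpoint 1 when 1/2 is written as a convex combination of s/2
    and 1; for the point s the corresponding weight is \<open>1 - 2 * q\<close>.\<close>
  define q where "q = (1 - s) / (2 - s)"
  have q: "0 \<le> q" "2 * q \<le> 1" "q * (2 - s) = 1 - s" using s by (auto simp: q_def field_simps)
  have "g s \<le> (1 - (1 - 2 * q)) * g (s/2) + (1 - 2 * q) * g 1"
    by (rule cg) (use s q in \<open>auto simp: algebra_simps\<close>)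
  moreover have "g (1/2) \<le> (1 - q) * g (s/2) + q * g 1"
    by (rule cg) (use s q in auto)
  ultimately have "g s + 2 * g (1/2) \<le> 2 * g (s/2) + g 1" by (simp add: algebra_simps)
  moreover have m: "(x + (x + s * (y - x))) / 2 = x + (s/2) * (y - x)" "(x + y) / 2 = x + (1/2) * (y - x)"
    by (simp_all add: field_simps)
  ultimately show ?thesis unfolding midpoint_gap_def m by (simp add: g_def add_divide_distrib)
qed

text \<open>An argument at distance at least e from x has, by monotonicity, a gap at least as large
  as that of \<open>x + e\<close> or \<open>x - e\<close>, and strict convexity makes these two
  fixed gaps positive.\<close>

lemma midpoint_gap_tendsto_imp:
  assumes fin: "\<psi> x < \<infinity>" "\<And>n. \<psi> (y n) < \<infinity>"
    and lim: "(\<lambda>n. midpoint_gap x (y n)) \<longlonglongrightarrow> 0"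
  shows "y \<longlonglongrightarrow> x"
proof (rule LIMSEQ_I)
  fix e :: real assume e: "0 < e"
  \<comment> \<open>The default 1 is any positive number: the domain is convex, so no
    \<open>y n\<close> lies beyond a point of infinite value.\<close>
  define d where "d z = (if \<psi> z < \<infinity> then midpoint_gap x z else 1)" for z
  have dpos: "0 < d z" if "z \<noteq> x" for z using midpoint_gap_pos[OF fin(1)] that by (auto simp: d_def)
  have far: "min (d (x + e)) (d (x - e)) \<le> midpoint_gap x (y n)" if "e \<le> \<bar>y n - x\<bar>" for n
  proof -
    define s where "s = e / \<bar>y n - x\<bar>"
    have s: "0 < s" "s \<le> 1" using e that by (auto simp: s_def)
    define z where "z = x + s * (y n - x)"
    have z: "z = x + e \<or> z = x - e" using e that by (auto simp: z_def s_def abs_if field_simps)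
    have "\<psi> ((1 - s) * x + s * y n) < \<infinity>" by (rule convex_real(1)) (use fin s in auto)
    then have "\<psi> z < \<infinity>" by (simp add: z_def algebra_simps)
    then have "d z \<le> midpoint_gap x (y n)"
      using midpoint_gap_mono[OF fin(1) fin(2)[of n] s] by (simp add: d_def z_def)
    then show ?thesis using z by auto
  qed
  have "0 < min (d (x + e)) (d (x - e))" using dpos e by simp
  from LIMSEQ_D[OF lim this] show "\<exists>no. \<forall>n\<ge>no. norm (y n - x) < e"
    using far by (fastforce simp: not_less[symmetric])
qed

end


section \<open>Weak lower semicontinuity and densities\<close>

text \<open>Testing with indicators suits both uses: a Tychonoff argument produces exactly this, and
  integrals of affine functions over sets pass to the limit. With a norm bound it extends to all
  bounded measurable test functions, see \<open>converges_on_sets_imp_weak\<close>.\<close>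

definition converges_on_sets :: "'s measure \<Rightarrow> 'j filter \<Rightarrow> ('j \<Rightarrow> 's \<Rightarrow> real) \<Rightarrow> ('s \<Rightarrow> real) \<Rightarrow> bool" where
  "converges_on_sets M F u f \<longleftrightarrow> (\<forall>A\<in>sets M.
     ((\<lambda>j. \<integral>s. u j s * indicator A s \<partial>M) \<longlongrightarrow> (\<integral>s. f s * indicator A s \<partial>M)) F)"

text \<open>Partial maxima turn the countable supremum into an increasing sequence for monotone
  convergence. The start at 0 reproduces the cut-off made by \<open>ennreal\<close>.\<close>

primrec affine_max :: "(nat \<Rightarrow> real) \<Rightarrow> (nat \<Rightarrow> real) \<Rightarrow> nat \<Rightarrow> real \<Rightarrow> real" where
  "affine_max a b 0 t = 0"
| "affine_max a b (Suc n) t = max (affine_max a b n t) (a n * t + b n)"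

lemma affine_max_nonneg: "0 \<le> affine_max a b n t"
  by (induction n) auto

lemma SUP_affine_max: "(SUP n. ennreal (affine_max a b n t)) = (SUP n. ennreal (a n * t + b n))"
proof (rule antisym)
  have "ennreal (affine_max a b n t) \<le> (SUP n. ennreal (a n * t + b n))" for n
    by (induction n) (auto simp: max_def intro: SUP_upper)
  then show "(SUP n. ennreal (affine_max a b n t)) \<le> (SUP n. ennreal (a n * t + b n))"
    by (intro SUP_least)
  show "(SUP n. ennreal (a n * t + b n)) \<le> (SUP n. ennreal (affine_max a b n t))"
  proof (rule SUP_least)
    fix n show "ennreal (a n * t + b n) \<le> (SUP n. ennreal (affine_max a b n t))"
      by (rule SUP_upper2[of "Suc n"]) (auto intro: ennreal_leI)
  qed
qed

lemma measurable_affine_max [measurable]: "affine_max a b n \<in> borel_measurable borel"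
  by (induction n) (simp_all add: measurable_cong[OF affine_max.simps(1)]
    measurable_cong[OF affine_max.simps(2)])

lemma (in finite_measure) integrable_affine_max:
  assumes "integrable M u"
  shows "integrable M (\<lambda>s. affine_max a b n (u s))"
  using assms by (induction n) auto

text \<open>Where f selects one affine function, its integral passes to the limit, and the maximum
  at \<open>u j\<close> dominates that function. The induction therefore splits A by the choice made
  at f and spends half of e on each piece, which requires A and e to be arbitrary.\<close>

lemma (in finite_measure) integral_affine_max_lsc:
  assumes "\<forall>\<^sub>F j in F. integrable M (u j)" "integrable M f" "converges_on_sets M F u f"
    and "A \<in> sets M" "0 < e"
  shows "\<forall>\<^sub>F j in F. (\<integral>s. affine_max a b n (f s) * indicator A s \<partial>M) - e
    < (\<integral>s. affine_max a b n (u j s) * indicator A s \<partial>M)"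
  using assms(4,5)
proof (induction n arbitrary: A e)
  case (Suc n)
  note [measurable] = borel_measurable_integrable[OF assms(2)] Suc.prems(1)
  \<comment> \<open>The limit f decides the split, not \<open>u j\<close>, so that P and Q stay
    fixed along the filter.\<close>
  define P where "P = A \<inter> {s \<in> space M. a n * f s + b n \<le> affine_max a b n (f s)}"
  define Q where "Q = A \<inter> {s \<in> space M. affine_max a b n (f s) < a n * f s + b n}"
  have [measurable]: "P \<in> sets M" "Q \<in> sets M" by (simp_all add: P_def Q_def)
  have PQ: "indicator A s = (indicator P s + indicator Q s :: real)" for s
    using sets.sets_into_space[OF Suc.prems(1)]
    by (auto simp: P_def Q_def indicator_def)
  have split: "(\<integral>s. w s * indicator A s \<partial>M) = (\<integral>s. w s * indicator P s \<partial>M) + (\<integral>s. w s * indicator Q s \<partial>M)"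
    if "integrable M w" for w :: "'a \<Rightarrow> real"
    unfolding PQ distrib_left
    by (intro Bochner_Integration.integral_add integrable_real_mult_indicator that) auto
  have "((\<lambda>j. a n * (\<integral>s. u j s * indicator Q s \<partial>M) + b n * measure M Q) \<longlongrightarrow>
      a n * (\<integral>s. f s * indicator Q s \<partial>M) + b n * measure M Q) F"
    using assms(3) by (intro tendsto_intros) (simp add: converges_on_sets_def)
  then have "\<forall>\<^sub>F j in F. a n * (\<integral>s. f s * indicator Q s \<partial>M) + b n * measure M Q - e / 2
      < a n * (\<integral>s. u j s * indicator Q s \<partial>M) + b n * measure M Q"
    by (rule order_tendstoD) (use Suc.prems in simp)
  moreover have "\<forall>\<^sub>F j in F. (\<integral>s. affine_max a b n (f s) * indicator P s \<partial>M) - e / 2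
    < (\<integral>s. affine_max a b n (u j s) * indicator P s \<partial>M)"
    using Suc.IH[of P "e / 2"] Suc.prems by simp
  ultimately show ?case using assms(1)
  proof eventually_elim
    case (elim j)
    have aff: "(\<integral>s. (a n * w s + b n) * indicator Q s \<partial>M) =
        a n * (\<integral>s. w s * indicator Q s \<partial>M) + b n * measure M Q" if "integrable M w" for w
    proof -
      have "(\<integral>s. (a n * w s + b n) * indicator Q s \<partial>M) =
          (\<integral>s. a n * (w s * indicator Q s) + b n * indicator Q s \<partial>M)"
        by (simp add: algebra_simps)
      also have "\<dots> = (\<integral>s. a n * (w s * indicator Q s) \<partial>M) + (\<integral>s. b n * indicator Q s \<partial>M)"
        using that by (intro Bochner_Integration.integral_add integrable_mult_right
            integrable_real_mult_indicator) (auto simp: integrable_indicator_iff less_top[symmetric])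
      finally show ?thesis by simp
    qed
    have *: "integrable M (\<lambda>s. affine_max a b (Suc n) (f s))" "integrable M (\<lambda>s. affine_max a b (Suc n) (u j s))"
      by (intro integrable_affine_max assms(2) elim(3))+
    have "(\<integral>s. affine_max a b (Suc n) (f s) * indicator A s \<partial>M) =
        (\<integral>s. affine_max a b n (f s) * indicator P s \<partial>M) + (\<integral>s. (a n * f s + b n) * indicator Q s \<partial>M)"
      unfolding split[OF *(1)]
      by (intro arg_cong2[where f = "(+)"] Bochner_Integration.integral_cong)
        (auto simp: P_def Q_def indicator_def)
    also have "\<dots> - e < (\<integral>s. affine_max a b n (u j s) * indicator P s \<partial>M) + (\<integral>s. (a n * u j s + b n) * indicator Q s \<partial>M)"
      using elim(1,2) unfolding aff[OF assms(2)] aff[OF elim(3)] by simp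
    also have "\<dots> \<le> (\<integral>s. affine_max a b (Suc n) (u j s) * indicator A s \<partial>M)"
      unfolding split[OF *(2)]
      using assms(2) elim(3) *(2)
      by (intro add_mono integral_mono integrable_real_mult_indicator integrable_affine_max)
        (auto simp: indicator_def)
    finally show ?case .
  qed
qed simp

text \<open>Monotone convergence is needed only at f: one finite affine maximum already integrates
  to more than v, and its own lower semicontinuity finishes, with no uniformity in j.\<close>

lemma (in superlinear_strictly_convex) nn_integral_le_Liminf:
  assumes "finite_measure M"
    and u: "\<forall>\<^sub>F j in F. integrable M (u j)" and f: "integrable M f" and conv: "converges_on_sets M F u f"
  shows "(\<integral>\<^sup>+ s. \<psi> (f s) \<partial>M) \<le> Liminf F (\<lambda>j. \<integral>\<^sup>+ s. \<psi> (u j s) \<partial>M)"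
  unfolding le_Liminf_iff
proof (intro allI impI)
  fix v assume v: "v < (\<integral>\<^sup>+ s. \<psi> (f s) \<partial>M)"
  interpret finite_measure M by fact
  obtain a b :: "nat \<Rightarrow> real" where ab: "\<And>t. \<psi> t = (SUP n. ennreal (a n * t + b n))"
    using affine_sup by blast
  then have \<psi>: "\<psi> t = (SUP n. ennreal (affine_max a b n t))" for t
    by (simp add: SUP_affine_max)
  have int: "(\<integral>\<^sup>+ s. ennreal (affine_max a b n (w s)) \<partial>M) = ennreal (\<integral>s. affine_max a b n (w s) * indicator (space M) s \<partial>M)"
    if "integrable M w" for n w
    using nn_integral_eq_integral[OF integrable_affine_max[OF that], of a b n]
    by (simp add: affine_max_nonneg cong: Bochner_Integration.integral_cong)
  note [measurable] = borel_measurable_integrable[OF f]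
  have "(\<integral>\<^sup>+ s. \<psi> (f s) \<partial>M) = (SUP n. \<integral>\<^sup>+ s. ennreal (affine_max a b n (f s)) \<partial>M)"
    unfolding \<psi>
    by (intro nn_integral_monotone_convergence_SUP)
      (auto intro!: incseq_SucI le_funI ennreal_leI)
  then obtain n where "v < (\<integral>\<^sup>+ s. ennreal (affine_max a b n (f s)) \<partial>M)"
    using v by (auto simp: less_SUP_iff)
  then have n: "v < ennreal (\<integral>s. affine_max a b n (f s) * indicator (space M) s \<partial>M)" (is "v < ennreal ?I")
    unfolding int[OF f] .
  then obtain r where r: "v = ennreal r" "0 \<le> r" by (cases v) auto
  then have "r < ?I" using n by (simp add: ennreal_less_iff)
  then have "\<forall>\<^sub>F j in F. ?I - (?I - r) < (\<integral>s. affine_max a b n (u j s) * indicator (space M) s \<partial>M)"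
    by (intro integral_affine_max_lsc u f conv) auto
  with u show "\<forall>\<^sub>F j in F. v < (\<integral>\<^sup>+ s. \<psi> (u j s) \<partial>M)"
  proof eventually_elim
    case (elim j)
    have "v < (\<integral>\<^sup>+ s. ennreal (affine_max a b n (u j s)) \<partial>M)"
      unfolding int[OF elim(1)] using elim(2) r by (simp add: ennreal_less_iff)
    also have "\<dots> \<le> (\<integral>\<^sup>+ s. \<psi> (u j s) \<partial>M)"
      by (intro nn_integral_mono) (auto simp: \<psi> intro: SUP_upper)
    finally show ?case .
  qed
qed

text \<open>Absolute continuity in this uniform form does two things: it gives continuity along sets
  decreasing to the empty set, which turns finite into countable additivity, and it kills null sets,
  as Radon-Nikodym demands.\<close>

lemma (in finite_measure) density_of_set_function:
  fixes \<nu> :: "'a set \<Rightarrow> real"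
  assumes nonneg: "\<And>A. A \<in> sets M \<Longrightarrow> 0 \<le> \<nu> A"
    and add: "\<And>A B. A \<in> sets M \<Longrightarrow> B \<in> sets M \<Longrightarrow> A \<inter> B = {} \<Longrightarrow> \<nu> (A \<union> B) = \<nu> A + \<nu> B"
    and ac: "\<And>e. 0 < e \<Longrightarrow> \<exists>d>0. \<forall>A\<in>sets M. measure M A < d \<longrightarrow> \<nu> A < e"
  shows "\<exists>h. integrable M h \<and> (\<forall>s. 0 \<le> h s) \<and> (\<forall>A\<in>sets M. \<nu> A = (\<integral>s. h s * indicator A s \<partial>M))"
proof -
  define N where "N = measure_of (space M) (sets M) (\<lambda>A. ennreal (\<nu> A))"
  have [simp, measurable_cong]: "sets N = sets M" by (simp add: N_def)
  have small: "\<nu> A = 0" if "A \<in> sets M" "measure M A = 0" for A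
  proof (rule ccontr)
    assume "\<nu> A \<noteq> 0"
    then have "0 < \<nu> A" using nonneg[OF that(1)] by simp
    from ac[OF this] show False using that by auto
  qed
  have emN: "emeasure N A = ennreal (\<nu> A)" if "A \<in> sets M" for A
    unfolding N_def
  proof (rule emeasure_measure_of_sigma[OF _ _ _ that])
    show "sigma_algebra (space M) (sets M)" ..
    show pos: "positive (sets M) (\<lambda>A. ennreal (\<nu> A))" using small[of "{}"] by (simp add: positive_def)
    have "additive (sets M) (\<lambda>A. ennreal (\<nu> A))"
      using add nonneg by (auto simp: additive_def ennreal_plus)
    with pos show "countably_additive (sets M) (\<lambda>A. ennreal (\<nu> A))"
    proof (rule sets.empty_continuous_imp_countably_additive)
      fix A :: "nat \<Rightarrow> 'a set"
      assume A: "range A \<subseteq> sets M" "decseq A" "(\<Inter>i. A i) = {}"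
      have "(\<lambda>i. measure M (A i)) \<longlonglongrightarrow> measure M (\<Inter>i. A i)"
        using A by (intro finite_Lim_measure_decseq)
      then have lim: "(\<lambda>i. measure M (A i)) \<longlonglongrightarrow> 0" using A by simp
      have "(\<lambda>i. \<nu> (A i)) \<longlonglongrightarrow> 0"
      proof (rule order_tendstoI)
        fix y :: real assume "y < 0"
        then show "\<forall>\<^sub>F i in sequentially. y < \<nu> (A i)"
          using A nonneg by (intro always_eventually allI) (meson order_less_le_trans range_subsetD)
      next
        fix e :: real assume "0 < e"
        from ac[OF this] obtain d where d: "0 < d" "\<forall>A\<in>sets M. measure M A < d \<longrightarrow> \<nu> A < e" by blast
        from order_tendstoD(2)[OF lim d(1)] show "\<forall>\<^sub>F i in sequentially. \<nu> (A i) < e"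
          by eventually_elim (use d A in auto)
      qed
      then show "(\<lambda>i. ennreal (\<nu> (A i))) \<longlonglongrightarrow> 0" using tendsto_ennrealI by fastforce
    qed simp
  qed
  have "absolutely_continuous M N"
    unfolding absolutely_continuous_def
    by (auto simp: null_sets_def emN small measure_def)
  then obtain f where f [measurable]: "f \<in> borel_measurable M" and N: "density M f = N"
    using Radon_Nikodym[OF _ \<open>sets N = sets M\<close>] by blast
  have fA: "(\<integral>\<^sup>+ s. f s * indicator A s \<partial>M) = ennreal (\<nu> A)" if "A \<in> sets M" for A
    using emeasure_density[OF f that] emN[OF that] N by simp
  have tot: "(\<integral>\<^sup>+ s. f s \<partial>M) \<noteq> \<infinity>"
    using fA[of "space M"] by (simp cong: nn_integral_cong)
  then have fin: "AE s in M. f s \<noteq> \<infinity>" by (intro nn_integral_PInf_AE) auto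
  have fh: "AE s in M. ennreal (enn2real (f s)) = f s"
    using fin by eventually_elim (simp add: less_top)
  have "(\<integral>\<^sup>+ s. ennreal (enn2real (f s)) \<partial>M) = (\<integral>\<^sup>+ s. f s \<partial>M)"
    by (intro nn_integral_cong_AE fh)
  then have int: "integrable M (\<lambda>s. enn2real (f s))"
    using tot by (intro integrableI_nonneg) (auto simp: less_top)
  moreover have "\<nu> A = (\<integral>s. enn2real (f s) * indicator A s \<partial>M)" if [measurable]: "A \<in> sets M" for A
  proof -
    have "ennreal (\<integral>s. enn2real (f s) * indicator A s \<partial>M) = (\<integral>\<^sup>+ s. ennreal (enn2real (f s) * indicator A s) \<partial>M)"
      using int by (intro nn_integral_eq_integral[symmetric] integrable_real_mult_indicator) auto
    also have "\<dots> = (\<integral>\<^sup>+ s. f s * indicator A s \<partial>M)"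
      using fh by (intro nn_integral_cong_AE) (auto elim!: eventually_mono simp: indicator_def)
    finally have "ennreal (\<integral>s. enn2real (f s) * indicator A s \<partial>M) = ennreal (\<nu> A)"
      unfolding fA[OF that] .
    moreover have "0 \<le> (\<integral>s. enn2real (f s) * indicator A s \<partial>M)"
      by (intro integral_nonneg_AE) auto
    ultimately show ?thesis using nonneg[OF that] by (simp only: ennreal_inj)
  qed
  ultimately show ?thesis by (intro exI[of _ "\<lambda>s. enn2real (f s)"]) auto
qed

lemma
  fixes v q :: "'a \<Rightarrow> real"
  assumes v: "integrable M v" and [measurable]: "q \<in> borel_measurable M" and q: "\<And>s. \<bar>q s\<bar> \<le> c"
  shows integrable_mult_bounded: "integrable M (\<lambda>s. v s * q s)"
    and integral_mult_bounded: "\<bar>\<integral>s. v s * q s \<partial>M\<bar> \<le> c * (\<integral>s. \<bar>v s\<bar> \<partial>M)"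
proof -
  have le: "\<bar>v s * q s\<bar> \<le> c * \<bar>v s\<bar>" for s
    unfolding abs_mult mult.commute[of "\<bar>v s\<bar>"] by (rule mult_right_mono) (use q in auto)
  have cv: "integrable M (\<lambda>s. c * \<bar>v s\<bar>)" using v by simp
  then show int: "integrable M (\<lambda>s. v s * q s)"
  proof (rule Bochner_Integration.integrable_bound)
    show "(\<lambda>s. v s * q s) \<in> borel_measurable M" using v by measurable
    show "AE s in M. norm (v s * q s) \<le> norm (c * \<bar>v s\<bar>)"
      using order_trans[OF le abs_ge_self] by simp
  qed
  have "\<bar>\<integral>s. v s * q s \<partial>M\<bar> \<le> (\<integral>s. \<bar>v s * q s\<bar> \<partial>M)" by (rule integral_abs_bound)
  also have "\<dots> \<le> (\<integral>s. c * \<bar>v s\<bar> \<partial>M)"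
    using int cv le by (intro integral_mono) auto
  finally show "\<bar>\<integral>s. v s * q s \<partial>M\<bar> \<le> c * (\<integral>s. \<bar>v s\<bar> \<partial>M)" by simp
qed

text \<open>Adding \<open>B\<close> times the measure makes the set function of the functional nonnegative, so that no
  Jordan decomposition is needed.\<close>

lemma (in finite_measure) L1_functional_density:
  fixes L :: "('a \<Rightarrow> real) \<Rightarrow> real"
  assumes add: "\<And>f g. integrable M f \<Longrightarrow> integrable M g \<Longrightarrow> L (\<lambda>s. f s + g s) = L f + L g"
    and scale: "\<And>c f. integrable M f \<Longrightarrow> L (\<lambda>s. c * f s) = c * L f"
    and bound: "\<And>f. integrable M f \<Longrightarrow> \<bar>L f\<bar> \<le> B * (\<integral>s. \<bar>f s\<bar> \<partial>M)" and "0 \<le> B"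
  shows "\<exists>g. g \<in> borel_measurable M \<and> (\<forall>s. \<bar>g s\<bar> \<le> B) \<and> (\<forall>f. integrable M f \<longrightarrow> L f = (\<integral>s. f s * g s \<partial>M))"
proof -
  have ind: "integrable M (indicator A :: 'a \<Rightarrow> real)" if "A \<in> sets M" for A
    using that by (simp add: integrable_indicator_iff less_top[symmetric])
  define \<nu> where "\<nu> A = L (indicator A) + B * measure M A" for A
  have L\<nu>: "\<bar>L (indicator A)\<bar> \<le> B * measure M A" if "A \<in> sets M" for A
    using bound[OF ind[OF that]] that by simp
  have \<nu>0: "0 \<le> \<nu> A" and \<nu>2: "\<nu> A \<le> 2 * B * measure M A" if "A \<in> sets M" for A
    using L\<nu>[OF that] by (auto simp: \<nu>_def)
  have "\<exists>h. integrable M h \<and> (\<forall>s. 0 \<le> h s) \<and> (\<forall>A\<in>sets M. \<nu> A = (\<integral>s. h s * indicator A s \<partial>M))"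
  proof (rule density_of_set_function)
    fix A1 A2 assume A: "A1 \<in> sets M" "A2 \<in> sets M" "A1 \<inter> A2 = {}"
    have "(indicator (A1 \<union> A2) :: 'a \<Rightarrow> real) = (\<lambda>s. indicator A1 s + indicator A2 s)"
      using A(3) by (intro ext) (auto simp: indicator_def)
    then show "\<nu> (A1 \<union> A2) = \<nu> A1 + \<nu> A2"
      using A add[OF ind ind, of A1 A2] by (simp add: \<nu>_def finite_measure_Union algebra_simps)
  next
    fix e :: real assume e: "0 < e"
    \<comment> \<open>The summand 1 keeps the denominator positive when B is 0.\<close>
    define d where "d = e / (2 * B + 1)"
    have "0 < d" using e \<open>0 \<le> B\<close> by (simp add: d_def)
    moreover have "\<nu> A < e" if "A \<in> sets M" "measure M A < d" for A
    proof -
      have "\<nu> A \<le> (2 * B + 1) * measure M A"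
        using \<nu>2[OF that(1)] by (simp add: algebra_simps) (smt (verit) measure_nonneg)
      also have "\<dots> < (2 * B + 1) * d" using that \<open>0 \<le> B\<close> by (intro mult_strict_left_mono) auto
      finally show ?thesis using \<open>0 \<le> B\<close> by (simp add: d_def)
    qed
    ultimately show "\<exists>d>0. \<forall>A\<in>sets M. measure M A < d \<longrightarrow> \<nu> A < e" by blast
  qed (rule \<nu>0)
  then obtain h where h: "integrable M h" "\<And>s. 0 \<le> h s" "\<And>A. A \<in> sets M \<Longrightarrow> \<nu> A = (\<integral>s. h s * indicator A s \<partial>M)"
    by blast
  note [measurable] = borel_measurable_integrable[OF h(1)]
  \<comment> \<open>Subtracting B undoes the shift in \<nu>. Truncating h at \<open>2 * B\<close>,
    which turns out not to alter the integrals, makes the bound hold at every point and not merely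
    almost everywhere.\<close>
  define g where "g s = min (h s) (2 * B) - B" for s
  have gm [measurable]: "g \<in> borel_measurable M" unfolding g_def[abs_def] by simp
  have gB: "\<bar>g s\<bar> \<le> B" for s using h(2)[of s] \<open>0 \<le> B\<close> by (auto simp: g_def min_def)
  note fg = integrable_mult_bounded[OF _ gm gB]
  define L' where "L' f = L f - (\<integral>s. f s * g s \<partial>M)" for f
  have L'ind: "L' (indicator A) = 0" if A [measurable]: "A \<in> sets M" for A
  proof -
    \<comment> \<open>C is where the truncation acts within A. There \<nu> is at most
      \<open>2 * B\<close> times the measure, so the part cut off has an integral of at most 0,
      hence equal to 0.\<close>
    define C where "C = A \<inter> {s \<in> space M. 2 * B < h s}"
    have C [measurable]: "C \<in> sets M" by (simp add: C_def)
    have "(\<integral>s. (h s - min (h s) (2 * B)) * indicator A s \<partial>M) = (\<integral>s. h s * indicator C s - 2 * B * indicator C s \<partial>M)"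
      by (intro Bochner_Integration.integral_cong) (auto simp: C_def indicator_def min_def)
    also have "\<dots> = \<nu> C - 2 * B * measure M C"
      using h(3)[OF C] integrable_real_mult_indicator[OF C h(1)] ind[OF C]
      by (subst Bochner_Integration.integral_diff) auto
    also have "\<dots> \<le> 0" using \<nu>2[OF C] by simp
    finally have "(\<integral>s. (h s - min (h s) (2 * B)) * indicator A s \<partial>M) \<le> 0" .
    moreover have "0 \<le> (\<integral>s. (h s - min (h s) (2 * B)) * indicator A s \<partial>M)"
      by (intro integral_nonneg_AE) auto
    moreover have "(\<integral>s. (h s - min (h s) (2 * B)) * indicator A s \<partial>M)
        = (\<integral>s. h s * indicator A s - (indicator A s * g s + B * indicator A s) \<partial>M)"
      by (intro Bochner_Integration.integral_cong) (auto simp: g_def algebra_simps)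
    moreover have "\<dots> = \<nu> A - ((\<integral>s. indicator A s * g s \<partial>M) + B * measure M A)"
    proof -
      have i1: "integrable M (\<lambda>s. h s * indicator A s)" using integrable_real_mult_indicator[OF A h(1)] .
      have i2: "integrable M (\<lambda>s. indicator A s * g s)" using fg[OF ind[OF A]] .
      have i3: "integrable M (\<lambda>s. B * indicator A s)" using ind[OF A] by (rule integrable_mult_right)
      show ?thesis
        using Bochner_Integration.integral_diff[OF i1 Bochner_Integration.integrable_add[OF i2 i3]]
          Bochner_Integration.integral_add[OF i2 i3] h(3)[OF A] by simp
    qed
    ultimately show ?thesis by (simp add: L'_def \<nu>_def)
  qed
  have L'add: "L' (\<lambda>s. f1 s + f2 s) = L' f1 + L' f2" if "integrable M f1" "integrable M f2" for f1 f2
    using add[OF that] fg[OF that(1)] fg[OF that(2)] by (simp add: L'_def distrib_right)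
  have L'scale: "L' (\<lambda>s. c * f s) = c * L' f" if "integrable M f" for c f
    using scale[OF that] by (simp add: L'_def mult.assoc right_diff_distrib)
  have L'bound: "\<bar>L' f\<bar> \<le> 2 * B * (\<integral>s. \<bar>f s\<bar> \<partial>M)" if "integrable M f" for f
    using bound[OF that] integral_mult_bounded[OF that gm gB] by (simp add: L'_def)
  \<comment> \<open>After subtraction of the candidate, the remainder vanishes on indicators and is
    linear with bound \<open>2 * B\<close>; approximation by simple functions then makes it vanish
    everywhere.\<close>
  have "L' f = 0" if "integrable M f" for f
    using that
  proof (induction rule: integrable_induct)
    case (base A c)
    then show ?case using L'scale[OF ind, of A c] L'ind[of A] by (simp add: mult.commute)
  next
    case (add f g)
    then show ?case using L'add by simp
  next
    case (lim f w)
    note [measurable] = borel_measurable_integrable[OF lim.hyps(1)] borel_measurable_integrable[OF lim.hyps(4)]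
    \<comment> \<open>The simple approximants are bounded by twice |f|, whence the dominating factor
      3.\<close>
    have "(\<lambda>i. \<integral>s. \<bar>f s - w i s\<bar> \<partial>M) \<longlonglongrightarrow> (\<integral>s. 0 \<partial>M)"
    proof (rule integral_dominated_convergence[where w = "\<lambda>s. 3 * \<bar>f s\<bar>"])
      show "AE s in M. (\<lambda>i. \<bar>f s - w i s\<bar>) \<longlonglongrightarrow> 0"
      proof (rule AE_I2)
        fix s assume "s \<in> space M"
        from tendsto_rabs[OF tendsto_diff[OF tendsto_const lim.hyps(2)[OF this], of "f s"]]
        show "(\<lambda>i. \<bar>f s - w i s\<bar>) \<longlonglongrightarrow> 0" by simp
      qed
      show "AE s in M. norm \<bar>f s - w i s\<bar> \<le> 3 * \<bar>f s\<bar>" for i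
      proof (rule AE_I2)
        fix s assume "s \<in> space M"
        from lim.hyps(3)[OF this, of i] show "norm \<bar>f s - w i s\<bar> \<le> 3 * \<bar>f s\<bar>"
          unfolding real_norm_def by linarith
      qed
    next
      show "integrable M (\<lambda>s. 3 * \<bar>f s\<bar>)" using lim.hyps(4) by simp
    qed (simp_all, measurable)
    then have "(\<lambda>i. 2 * B * (\<integral>s. \<bar>f s - w i s\<bar> \<partial>M)) \<longlonglongrightarrow> 2 * B * 0"
      by (intro tendsto_mult tendsto_const) simp
    moreover have "\<bar>L' f\<bar> \<le> 2 * B * (\<integral>s. \<bar>f s - w i s\<bar> \<partial>M)" for i
    proof -
      have "L' f = L' (\<lambda>s. w i s + (f s - w i s))" by simp
      also have "\<dots> = L' (\<lambda>s. f s - w i s)"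
        using L'add[OF lim.hyps(1)[of i], of "\<lambda>s. f s - w i s"] lim.hyps lim.IH by simp
      finally show ?thesis using L'bound[of "\<lambda>s. f s - w i s"] lim.hyps(1,4) by simp
    qed
    ultimately have "\<bar>L' f\<bar> \<le> 2 * B * 0" by (intro LIMSEQ_le_const) auto
    then show ?case by simp
  qed
  then show ?thesis using gB gm by (intro exI[of _ g]) (auto simp: L'_def)
qed

text \<open>A bounded g is uniformly close to a function with finitely many values, for which the
  claim is a finite sum of limits on sets. The common norm bound K controls the error for all j at
  once.\<close>

lemma (in finite_measure) converges_on_sets_imp_weak:
  assumes u: "\<forall>\<^sub>F j in F. integrable M (u j) \<and> (\<integral>s. \<bar>u j s\<bar> \<partial>M) \<le> K" and f: "integrable M f"
    and conv: "converges_on_sets M F u f"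
    and [measurable]: "g \<in> borel_measurable M" and gB: "\<And>s. \<bar>g s\<bar> \<le> B"
  shows "((\<lambda>j. \<integral>s. u j s * g s \<partial>M) \<longlongrightarrow> (\<integral>s. f s * g s \<partial>M)) F"
proof (rule tendstoI)
  fix e :: real assume e: "0 < e"
  \<comment> \<open>A positive strict bound for the norms of f and of eventually all
    \<open>u j\<close>; d is then chosen so that rounding g down to multiples of d costs at most e /
    3.\<close>
  define K' where "K' = max K (\<integral>s. \<bar>f s\<bar> \<partial>M) + 1"
  have "0 \<le> (\<integral>s. \<bar>f s\<bar> \<partial>M)" "(\<integral>s. \<bar>f s\<bar> \<partial>M) \<le> max K (\<integral>s. \<bar>f s\<bar> \<partial>M)" by simp_all
  then have K': "0 < K'" unfolding K'_def by linarith
  define d where "d = e / (3 * K')"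
  have d: "0 < d" using e K' by (simp add: d_def)
  \<comment> \<open>Since g is bounded by B, the levels \<open>\<lfloor>g s / d\<rfloor>\<close>
    stay within \<open>{-m..m}\<close>, so finitely many level sets suffice.\<close>
  define m where "m = \<lceil>B / d\<rceil> + 1"
  define A where "A k = {s \<in> space M. \<lfloor>g s / d\<rfloor> = k}" for k
  have [measurable]: "A k \<in> sets M" for k by (simp add: A_def)
  define w where "w s = d * \<lfloor>g s / d\<rfloor>" for s
  have wm [measurable]: "w \<in> borel_measurable M" unfolding w_def[abs_def] by simp
  have gw: "\<bar>g s - w s\<bar> \<le> d" for s
  proof -
    have "g s = d * (g s / d)" using d by simp
    then have "g s - w s = d * (g s / d - \<lfloor>g s / d\<rfloor>)" by (simp add: w_def right_diff_distrib)
    moreover have "0 \<le> g s / d - \<lfloor>g s / d\<rfloor>" "g s / d - \<lfloor>g s / d\<rfloor> \<le> 1" by linarith+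
    ultimately show ?thesis using d by (simp add: abs_mult)
  qed
  have w_sum: "w s = (\<Sum>k\<in>{-m..m}. d * k * indicator (A k) s)" if s: "s \<in> space M" for s
  proof -
    have "\<bar>g s / d\<bar> \<le> B / d" using gB[of s] d by (simp add: divide_right_mono)
    then have mem: "\<lfloor>g s / d\<rfloor> \<in> {-m..m}" 
    proof -
      assume *: "\<bar>g s / d\<bar> \<le> B / d"
      have "\<lfloor>g s / d\<rfloor> \<le> \<lceil>B / d\<rceil>" "- \<lceil>B / d\<rceil> - 1 \<le> \<lfloor>g s / d\<rfloor>" using * by linarith+
      then show ?thesis by (simp add: m_def)
    qed
    have "(\<Sum>k\<in>{-m..m}. d * k * indicator (A k) s) = (\<Sum>k\<in>{-m..m}. if k = \<lfloor>g s / d\<rfloor> then d * k else 0)"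
      using s by (intro sum.cong) (auto simp: A_def)
    also have "\<dots> = w s" using mem by (simp add: w_def)
    finally show ?thesis by simp
  qed
  have int_w: "(\<integral>s. v s * w s \<partial>M) = (\<Sum>k\<in>{-m..m}. d * k * (\<integral>s. v s * indicator (A k) s \<partial>M))"
    if "integrable M v" for v
  proof -
    have "(\<integral>s. v s * w s \<partial>M) = (\<integral>s. (\<Sum>k\<in>{-m..m}. d * k * (v s * indicator (A k) s)) \<partial>M)"
      by (intro Bochner_Integration.integral_cong refl) (simp add: w_sum sum_distrib_left mult_ac)
    also have "\<dots> = (\<Sum>k\<in>{-m..m}. (\<integral>s. d * k * (v s * indicator (A k) s) \<partial>M))"
      by (intro Bochner_Integration.integral_sum integrable_mult_right integrable_real_mult_indicator that) simp
    finally show ?thesis by simp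
  qed
  have wB: "\<bar>w s\<bar> \<le> B + d" for s using gw[of s] gB[of s] by linarith
  have close: "\<bar>(\<integral>s. v s * g s \<partial>M) - (\<integral>s. v s * w s \<partial>M)\<bar> < e / 3"
    if v: "integrable M v" "(\<integral>s. \<bar>v s\<bar> \<partial>M) < K'" for v
  proof -
    have "(\<integral>s. v s * g s \<partial>M) - (\<integral>s. v s * w s \<partial>M) = (\<integral>s. v s * (g s - w s) \<partial>M)"
      using integrable_mult_bounded[OF v(1) _ gB] integrable_mult_bounded[OF v(1) wm wB]
      by (simp add: right_diff_distrib)
    also have "\<bar>\<dots>\<bar> \<le> d * (\<integral>s. \<bar>v s\<bar> \<partial>M)"
      using v(1) gw by (intro integral_mult_bounded) auto
    also have "\<dots> < d * K'" using v(2) d by simp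
    also have "\<dots> = e / 3" using K' by (simp add: d_def)
    finally show ?thesis .
  qed
  have "((\<lambda>j. \<Sum>k\<in>{-m..m}. d * k * (\<integral>s. u j s * indicator (A k) s \<partial>M)) \<longlongrightarrow>
      (\<Sum>k\<in>{-m..m}. d * k * (\<integral>s. f s * indicator (A k) s \<partial>M))) F"
    using conv unfolding converges_on_sets_def by (intro tendsto_intros) auto
  then have "\<forall>\<^sub>F j in F. dist (\<Sum>k\<in>{-m..m}. d * k * (\<integral>s. u j s * indicator (A k) s \<partial>M))
      (\<Sum>k\<in>{-m..m}. d * k * (\<integral>s. f s * indicator (A k) s \<partial>M)) < e / 3"
    by (rule tendstoD) (use e in simp)
  with u show "\<forall>\<^sub>F j in F. dist (\<integral>s. u j s * g s \<partial>M) (\<integral>s. f s * g s \<partial>M) < e"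
  proof eventually_elim
    case (elim j)
    then have "\<bar>(\<integral>s. u j s * w s \<partial>M) - (\<integral>s. f s * w s \<partial>M)\<bar> < e / 3"
      using f by (simp add: int_w dist_real_def)
    moreover have "\<bar>(\<integral>s. u j s * g s \<partial>M) - (\<integral>s. u j s * w s \<partial>M)\<bar> < e / 3"
      using elim by (intro close) (auto simp: K'_def)
    moreover have "\<bar>(\<integral>s. f s * g s \<partial>M) - (\<integral>s. f s * w s \<partial>M)\<bar> < e / 3"
      using f by (intro close) (auto simp: K'_def)
    ultimately show ?case unfolding dist_real_def by linarith
  qed
qed


section \<open>Weak topology and the dual of \<open>L\<^sup>1\<close>\<close>

lemma ennreal_Liminf_add_le:
  fixes f g :: "'j \<Rightarrow> ennreal"
  shows "Liminf F f + Liminf F g \<le> Liminf F (\<lambda>x. f x + g x)"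
proof -
  let ?F = "{P. eventually P F}"
  have ne: "?F \<noteq> {}" using eventually_True by blast
  have "Liminf F f + Liminf F g =
      (SUP P\<in>?F. SUP Q\<in>?F. (INF x\<in>Collect P. f x) + (INF x\<in>Collect Q. g x))"
    unfolding Liminf_def
    by (subst ennreal_SUP_add_left[OF ne, symmetric], subst ennreal_SUP_add_right[OF ne, symmetric]) simp
  also have "\<dots> \<le> Liminf F (\<lambda>x. f x + g x)"
  proof (intro SUP_least)
    fix P Q assume PQ: "P \<in> ?F" "Q \<in> ?F"
    then have "eventually (\<lambda>x. P x \<and> Q x) F" by (simp add: eventually_conj)
    moreover have "(INF x\<in>Collect P. f x) + (INF x\<in>Collect Q. g x) \<le> (INF x\<in>{x. P x \<and> Q x}. f x + g x)"
      by (intro INF_greatest add_mono) (auto intro: INF_lower)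
    ultimately show "(INF x\<in>Collect P. f x) + (INF x\<in>Collect Q. g x) \<le> Liminf F (\<lambda>x. f x + g x)"
      unfolding Liminf_def by (intro SUP_upper2[of "\<lambda>x. P x \<and> Q x"]) auto
  qed
  finally show ?thesis .
qed

lemma ennreal_sum_Liminf_le:
  fixes f :: "'i \<Rightarrow> 'j \<Rightarrow> ennreal"
  assumes "F \<noteq> bot" "finite I"
  shows "(\<Sum>i\<in>I. Liminf F (f i)) \<le> Liminf F (\<lambda>x. \<Sum>i\<in>I. f i x)"
  using assms(2)
proof (induction I)
  case (insert i I)
  have "Liminf F (f i) + (\<Sum>i\<in>I. Liminf F (f i)) \<le> Liminf F (f i) + Liminf F (\<lambda>x. \<Sum>i\<in>I. f i x)"
    by (rule add_left_mono[OF insert.IH])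
  also have "\<dots> \<le> Liminf F (\<lambda>x. f i x + (\<Sum>i\<in>I. f i x))" by (rule ennreal_Liminf_add_le)
  finally show ?case using insert.hyps by simp
qed simp

text \<open>The image of F lives on a product of compact intervals, so by Tychonoff it has a cluster
  point p. This replaces the diagonal subsequence, since the index set may be uncountable.\<close>

lemma cluster_filter_bounded_functions:
  fixes \<Phi> :: "'a \<Rightarrow> 'i \<Rightarrow> real"
  assumes F: "F \<noteq> bot" and bd: "\<forall>\<^sub>F x in F. \<forall>i. \<bar>\<Phi> x i\<bar> \<le> B i"
  shows "\<exists>G p. G \<le> F \<and> G \<noteq> bot \<and> (\<forall>i. ((\<lambda>x. \<Phi> x i) \<longlongrightarrow> p i) G)"
proof -
  define P where "P = PiE UNIV (\<lambda>i. {- B i..B i})"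
  have "compactin (product_topology (\<lambda>i. euclidean) UNIV) P"
    unfolding P_def compactin_PiE by simp
  then have "compact P" by (simp add: euclidean_product_topology)
  moreover have "filtermap \<Phi> F \<noteq> bot" using F by (simp add: filtermap_bot_iff)
  moreover have "\<forall>\<^sub>F f in filtermap \<Phi> F. f \<in> P"
    unfolding eventually_filtermap using bd by eventually_elim (auto simp: P_def abs_le_iff minus_le_iff)
  ultimately obtain p where p: "inf (nhds p) (filtermap \<Phi> F) \<noteq> bot"
    unfolding compact_filter by blast
  \<comment> \<open>Forces \<Phi> to tend to p along a filter finer than F; that p is a cluster
    point of the image filter is what makes G proper.\<close>
  define G where "G = inf F (filtercomap \<Phi> (nhds p))"
  have "G \<noteq> bot"
  proof
    assume "G = bot"
    then have "eventually (\<lambda>_. False) (inf F (filtercomap \<Phi> (nhds p)))" by (simp add: G_def)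
    then obtain Q S where QS: "eventually Q F" "eventually S (filtercomap \<Phi> (nhds p))" "\<And>x. Q x \<Longrightarrow> S x \<Longrightarrow> False"
      unfolding eventually_inf by blast
    obtain R where R: "eventually R (nhds p)" "\<And>x. R (\<Phi> x) \<Longrightarrow> S x"
      using QS(2) unfolding eventually_filtercomap by blast
    have "eventually (\<lambda>f. \<not> R f) (filtermap \<Phi> F)"
      unfolding eventually_filtermap using QS(1) by eventually_elim (use QS(3) R(2) in blast)
    with R(1) have "eventually (\<lambda>_. False) (inf (nhds p) (filtermap \<Phi> F))"
      unfolding eventually_inf by blast
    with p show False by (simp add: trivial_limit_def)
  qed
  moreover have "G \<le> F" by (simp add: G_def)
  moreover have "((\<lambda>x. \<Phi> x i) \<longlongrightarrow> p i) G" for i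
  proof -
    have "filterlim \<Phi> (nhds p) G"
      unfolding G_def by (rule filterlim_mono[OF filterlim_filtercomap order_refl]) simp
    moreover have "((\<lambda>f :: 'i \<Rightarrow> real. f i) \<longlongrightarrow> p i) (nhds p)"
    proof (rule topological_tendstoI)
      fix U :: "real set" assume U: "open U" "p i \<in> U"
      have "open ((\<lambda>f :: 'i \<Rightarrow> real. f i) -` U)"
        by (rule open_vimage[OF U(1) continuous_on_product_coordinates])
      then show "\<forall>\<^sub>F f in nhds p. f i \<in> U"
        unfolding eventually_nhds using U(2) by blast
    qed
    ultimately show ?thesis by (rule filterlim_compose[rotated])
  qed
  ultimately show ?thesis by blast
qed

text \<open>Weakly open sets are generated from preimages under functionals; induction on the
  generation leaves only these, where the limits along G apply.\<close>

lemma tendsto_dual_imp_eventually_weakly_open: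
  assumes W: "openin (weak_topology X) W" "x \<in> W"
    and pts: "\<forall>\<^sub>F y in G. y \<in> points X" and lim: "\<And>l. l \<in> dual_space X \<Longrightarrow> (l \<longlongrightarrow> l x) G"
  shows "\<forall>\<^sub>F y in G. y \<in> W"
proof -
  have "generate_topology_on {{x \<in> points X. l x \<in> U} | l U. l \<in> dual_space X \<and> open U} W"
    using W(1) unfolding weak_topology_def by (rule openin_topology_generated_by)
  then show ?thesis using W(2)
  proof induction
    case (Int a b)
    then show ?case by (auto simp: eventually_conj_iff)
  next
    case (UN K)
    then obtain k where k: "k \<in> K" "x \<in> k" by blast
    with UN have "\<forall>\<^sub>F y in G. y \<in> k" by blast
    then show ?case by eventually_elim (use k in blast)
  next
    case (Basis s)
    then obtain l U where s: "s = {x \<in> points X. l x \<in> U}" "l \<in> dual_space X" "open U" by blast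
    have "\<forall>\<^sub>F y in G. l y \<in> U"
      using topological_tendstoD[OF lim[OF s(2)] s(3)] Basis s(1) by blast
    with pts show ?case by eventually_elim (simp add: s)
  qed simp
qed

text \<open>If no finite subfamily covers K, the sets K minus a member of the cover generate a
  proper filter. Its cluster point lies in some member U, which the finer filter would have to enter
  and to avoid.\<close>

lemma compactin_weak_topologyI:
  assumes sub: "K \<subseteq> points X"
    and cluster: "\<And>F. F \<noteq> bot \<Longrightarrow> \<forall>\<^sub>F y in F. y \<in> K \<Longrightarrow>
      \<exists>G x. G \<le> F \<and> G \<noteq> bot \<and> x \<in> K \<and> (\<forall>l\<in>dual_space X. (l \<longlongrightarrow> l x) G)"
  shows "compactin (weak_topology X) K"
  unfolding compactin_def
proof (intro conjI allI impI)
  show "K \<subseteq> topspace (weak_topology X)" using sub by (simp add: topspace_weak_topology)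
  fix \<U> assume \<U>: "Ball \<U> (openin (weak_topology X)) \<and> K \<subseteq> \<Union> \<U>"
  show "\<exists>\<F>. finite \<F> \<and> \<F> \<subseteq> \<U> \<and> K \<subseteq> \<Union> \<F>"
  proof (rule ccontr)
    assume none: "\<not> ?thesis"
    \<comment> \<open>The inserted empty set puts K itself into the filter without reference to a
      member of the cover.\<close>
    define F where "F = (INF U\<in>insert {} \<U>. principal (K - U))"
    have "F \<noteq> bot"
      unfolding F_def
    proof (rule INF_filter_not_bot)
      fix V assume V: "V \<subseteq> insert {} \<U>" "finite V"
      have "\<not> K \<subseteq> \<Union> (V - {{}})" using none V by (metis Diff_subset_conv finite_Diff insert_is_Un)
      then have "(\<Inter>U\<in>V. K - U) \<noteq> {}" by blast
      then show "(INF U\<in>V. principal (K - U)) \<noteq> bot"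
        unfolding INF_principal_finite[OF V(2)] by (simp add: principal_eq_bot_iff)
    qed
    moreover have ev: "\<forall>\<^sub>F y in F. y \<in> K - U" if "U \<in> insert {} \<U>" for U
      unfolding F_def by (rule eventually_INF1[OF that]) (simp add: eventually_principal)
    ultimately obtain G x where G: "G \<le> F" "G \<noteq> bot" "x \<in> K" "\<And>l. l \<in> dual_space X \<Longrightarrow> (l \<longlongrightarrow> l x) G"
      using cluster[of F] ev[of "{}"] by auto
    obtain U where U: "U \<in> \<U>" "x \<in> U" using G(3) \<U> by blast
    have inK: "\<forall>\<^sub>F y in G. y \<in> K - V" if "V \<in> insert {} \<U>" for V
      using filter_leD[OF G(1) ev[OF that]] .
    have "\<forall>\<^sub>F y in G. y \<in> points X" using inK[of "{}"] sub by (auto elim: eventually_mono)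
    then have "\<forall>\<^sub>F y in G. y \<in> U"
      using tendsto_dual_imp_eventually_weakly_open[of X U x G] \<U> U G(4) by blast
    moreover have "\<forall>\<^sub>F y in G. y \<in> K - U" using inK U by blast
    ultimately have "\<forall>\<^sub>F y in G. False" by eventually_elim blast
    then show False using G(2) by (simp add: trivial_limit_def)
  qed
qed

lemma limitin_weak_topology_imp_tendsto:
  assumes lim: "limitin (weak_topology X) u x F" and l: "l \<in> dual_space X"
  shows "((\<lambda>n. l (u n)) \<longlongrightarrow> l x) F"
proof (rule topological_tendstoI)
  fix U assume U: "open U" "l x \<in> U"
  have "openin (weak_topology X) {y \<in> points X. l y \<in> U}"
    unfolding weak_topology_def by (rule topology_generated_by_Basis) (use l U in blast)
  moreover have "x \<in> {y \<in> points X. l y \<in> U}"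
    using lim U by (simp add: limitin_def topspace_weak_topology)
  ultimately have "\<forall>\<^sub>F n in F. u n \<in> {y \<in> points X. l y \<in> U}"
    using lim unfolding limitin_def by blast
  then show "\<forall>\<^sub>F n in F. l (u n) \<in> U" by eventually_elim simp
qed

section \<open>Functionals on vector-valued L^1 and uniform integrability\<close>

lemma L1_class_L1_rep:
  assumes "x \<in> points (L1 M)"
  shows "integrable M (L1_rep x)" "L1_class M (L1_rep x) = x"
proof -
  obtain f where f: "x = L1_class M f" "integrable M f" using assms by (auto simp: L1_def)
  show "integrable M (L1_rep x)" using L1_rep_class(1)[OF f(2)] f(1) by simp
  show "L1_class M (L1_rep x) = x"
    unfolding f(1) by (rule L1_class_eqI) (rule L1_rep_class(2)[OF f(2)])
qed

lemma L1_class_in_points: "integrable M f \<Longrightarrow> L1_class M f \<in> points (L1 M)"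
  by (auto simp: L1_def)

lemma integrable_vec_nth:
  fixes f :: "'s \<Rightarrow> real ^ 'd"
  shows "integrable M f \<Longrightarrow> integrable M (\<lambda>s. f s $ i)"
  using integrable_bounded_linear[OF bounded_linear_vec_nth] .

lemma integrable_vec_lambda:
  fixes h :: "'d::finite \<Rightarrow> 's \<Rightarrow> real"
  assumes "\<And>i. integrable M (h i)"
  shows "integrable M (\<lambda>s. \<chi> i. h i s)"
proof -
  have "(\<lambda>s. \<chi> i. h i s) = (\<lambda>s. \<Sum>i\<in>UNIV. h i s *\<^sub>R axis i 1)"
    using basis_expansion[of "\<chi> i. h i _"] by (simp add: scalar_mult_eq_scaleR)
  then show ?thesis using assms by simp
qed

text \<open>Through these functionals, weak convergence yields convergence on sets in each
  coordinate.\<close>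

lemma coordinate_integral_in_dual_space:
  assumes A: "A \<in> sets M"
  shows "(\<lambda>x. \<integral>s. L1_rep x s $ i * indicator A s \<partial>M) \<in> dual_space (L1 M :: ('s \<Rightarrow> real ^ 'd) set normed_space)"
proof -
  have int: "integrable M (\<lambda>s. f s $ i * indicator A s)" if "integrable M f" for f :: "'s \<Rightarrow> real ^ 'd"
    using integrable_real_mult_indicator[OF A integrable_vec_nth[OF that]] .
  have cls: "(\<integral>s. L1_rep (L1_class M f) s $ i * indicator A s \<partial>M) = (\<integral>s. f s $ i * indicator A s \<partial>M)"
    if "integrable M f" for f :: "'s \<Rightarrow> real ^ 'd"
    using L1_rep_class(2)[OF that] borel_measurable_integrable[OF int[OF that]]
      borel_measurable_integrable[OF int[OF L1_rep_class(1)[OF that]]]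
    by (intro integral_cong_AE) (auto elim: eventually_mono)
  show ?thesis
    unfolding dual_space_def
  proof (intro CollectI conjI ballI allI exI[of _ 1])
    fix x y :: "('s \<Rightarrow> real ^ 'd) set" assume "x \<in> points (L1 M)" "y \<in> points (L1 M)"
    note x = L1_class_L1_rep[OF this(1)] and y = L1_class_L1_rep[OF this(2)]
    show "(\<integral>s. L1_rep (vadd (L1 M) x y) s $ i * indicator A s \<partial>M) =
      (\<integral>s. L1_rep x s $ i * indicator A s \<partial>M) + (\<integral>s. L1_rep y s $ i * indicator A s \<partial>M)"
      using L1_add[OF x(1) y(1)] cls[OF Bochner_Integration.integrable_add[OF x(1) y(1)]]
        int[OF x(1)] int[OF y(1)] unfolding x(2) y(2)
      by (simp add: distrib_right)
  next
    fix c and x :: "('s \<Rightarrow> real ^ 'd) set" assume "x \<in> points (L1 M)"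
    note x = L1_class_L1_rep[OF this]
    show "(\<integral>s. L1_rep (vscale (L1 M) c x) s $ i * indicator A s \<partial>M) = c * (\<integral>s. L1_rep x s $ i * indicator A s \<partial>M)"
      using L1_scale[OF x(1), of c] cls[OF integrable_scaleR_right[OF x(1)], of c] unfolding x(2)
      by (simp add: mult.assoc)
    have "\<bar>\<integral>s. L1_rep x s $ i * indicator A s \<partial>M\<bar> \<le> (\<integral>s. \<bar>L1_rep x s $ i * indicator A s\<bar> \<partial>M)"
      by (rule integral_abs_bound)
    also have "\<dots> \<le> (\<integral>s. norm (L1_rep x s) \<partial>M)"
      using int[OF x(1)] x(1) component_le_norm_cart
      by (intro integral_mono) (auto simp: indicator_def)
    finally show "\<bar>\<integral>s. L1_rep x s $ i * indicator A s \<partial>M\<bar> \<le> 1 * vnorm (L1 M) x"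
      using L1_norm[OF x(1)] x(2) by simp
  qed
qed

text \<open>Restricted to functions along one coordinate axis, l is a functional on scalar L^1 with
  the same bound, since axis vectors have norm 1. Finite additivity over the axes reassembles
  l.\<close>

lemma (in finite_measure) dual_space_L1_density:
  fixes l :: "('a \<Rightarrow> real ^ 'd) set \<Rightarrow> real"
  assumes l: "l \<in> dual_space (L1 M)"
  shows "\<exists>B g. (\<forall>i. g i \<in> borel_measurable M) \<and> (\<forall>i s. \<bar>g i s\<bar> \<le> B) \<and>
    (\<forall>f. integrable M f \<longrightarrow> l (L1_class M f) = (\<Sum>i\<in>UNIV. \<integral>s. f s $ i * g i s \<partial>M))"
proof -
  obtain B0 where B0: "\<And>x. x \<in> points (L1 M) \<Longrightarrow> \<bar>l x\<bar> \<le> B0 * vnorm (L1 M) x"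
    using l unfolding dual_space_def by blast
  have l_add: "l (vadd (L1 M) x y) = l x + l y" if "x \<in> points (L1 M)" "y \<in> points (L1 M)" for x y
    using l that unfolding dual_space_def by blast
  have l_scale: "l (vscale (L1 M) c x) = c * l x" if "x \<in> points (L1 M)" for c x
    using l that unfolding dual_space_def by blast
  \<comment> \<open>\<open>dual_space\<close> allows a negative constant, whereas the scalar
    representation asks for a nonnegative one.\<close>
  define B where "B = max 0 B0"
  have add: "l (L1_class M (\<lambda>s. f s + g s)) = l (L1_class M f) + l (L1_class M g)"
    if "integrable M f" "integrable M g" for f g
    using l_add[OF L1_class_in_points[OF that(1)] L1_class_in_points[OF that(2)]]
    unfolding L1_add[OF that] .
  have scale: "l (L1_class M (\<lambda>s. c *\<^sub>R f s)) = c * l (L1_class M f)" if "integrable M f" for f c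
    using l_scale[OF L1_class_in_points[OF that], of c] unfolding L1_scale[OF that] .
  have bound: "\<bar>l (L1_class M f)\<bar> \<le> B * (\<integral>s. norm (f s) \<partial>M)" if "integrable M f" for f
  proof -
    have "\<bar>l (L1_class M f)\<bar> \<le> B0 * (\<integral>s. norm (f s) \<partial>M)"
      using B0[OF L1_class_in_points[OF that]] L1_norm[OF that] by simp
    also have "\<dots> \<le> B * (\<integral>s. norm (f s) \<partial>M)" by (intro mult_right_mono) (auto simp: B_def)
    finally show ?thesis .
  qed
  define L where "L i v = l (L1_class M (\<lambda>s. v s *\<^sub>R axis i 1))" for i and v :: "'a \<Rightarrow> real"
  have ax: "integrable M (\<lambda>s. v s *\<^sub>R axis i 1 :: real ^ 'd)" if "integrable M v" for v i
    using that by simp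
  have "\<exists>g. g \<in> borel_measurable M \<and> (\<forall>s. \<bar>g s\<bar> \<le> B) \<and> (\<forall>f. integrable M f \<longrightarrow> L i f = (\<integral>s. f s * g s \<partial>M))" for i
  proof (rule L1_functional_density)
    fix v w :: "'a \<Rightarrow> real" assume vw: "integrable M v" "integrable M w"
    show "L i (\<lambda>s. v s + w s) = L i v + L i w"
      using add[OF ax[OF vw(1)] ax[OF vw(2)]] by (simp add: L_def scaleR_add_left)
    show "L i (\<lambda>s. c * v s) = c * L i v" for c
      using scale[OF ax[OF vw(1)], of c] by (simp add: L_def)
    show "\<bar>L i v\<bar> \<le> B * (\<integral>s. \<bar>v s\<bar> \<partial>M)"
      using bound[OF ax[OF vw(1)], of i] by (simp add: L_def)
  qed (simp add: B_def)
  then obtain g where g: "\<And>i. g i \<in> borel_measurable M" "\<And>i s. \<bar>g i s\<bar> \<le> B"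
      "\<And>i f. integrable M f \<Longrightarrow> L i f = (\<integral>s. f s * g i s \<partial>M)"
    by metis
  have sum: "l (L1_class M (\<lambda>s. \<Sum>i\<in>I. f i s)) = (\<Sum>i\<in>I. l (L1_class M (f i)))"
    if "finite I" "\<And>i. integrable M (f i)" for f :: "'d \<Rightarrow> 'a \<Rightarrow> real ^ 'd" and I
    using that(1)
  proof (induction I)
    case empty
    show ?case using scale[of "\<lambda>_. 0" 0] by simp
  next
    case (insert i I)
    then show ?case using add[of "f i" "\<lambda>s. \<Sum>i\<in>I. f i s"] that(2) by simp
  qed
  have "l (L1_class M f) = (\<Sum>i\<in>UNIV. \<integral>s. f s $ i * g i s \<partial>M)" if f: "integrable M f" for f
  proof -
    have "f = (\<lambda>s. \<Sum>i\<in>UNIV. f s $ i *\<^sub>R axis i 1)"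
      using basis_expansion[of "f _"] by (simp add: scalar_mult_eq_scaleR)
    then have "l (L1_class M f) = (\<Sum>i\<in>UNIV. L i (\<lambda>s. f s $ i))"
      using sum[of UNIV "\<lambda>i s. f s $ i *\<^sub>R axis i 1"] ax[OF integrable_vec_nth[OF f]] by (simp add: L_def)
    also have "\<dots> = (\<Sum>i\<in>UNIV. \<integral>s. f s $ i * g i s \<partial>M)"
      using g(3)[OF integrable_vec_nth[OF f]] by simp
    finally show ?thesis .
  qed
  then show ?thesis using g(1,2) by blast
qed

text \<open>The growth condition integrated over A, in the manner of de la Vallee Poussin. A large q
  makes r / q small uniformly over the level set, then a small A makes the other term small; with A
  the whole space it is a norm bound.\<close>

lemma (in superlinear_strictly_convex) integral_on_set_le:
  assumes "finite_measure M" and u: "integrable M u" and le: "(\<integral>\<^sup>+ s. \<psi> (u s) \<partial>M) \<le> ennreal r" "0 \<le> r"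
    and c: "0 \<le> c" "\<And>t. ennreal (q * \<bar>t\<bar>) \<le> ennreal c + \<psi> t" and q: "0 \<le> q" and A: "A \<in> sets M"
  shows "q * (\<integral>s. \<bar>u s\<bar> * indicator A s \<partial>M) \<le> c * measure M A + r"
proof -
  interpret finite_measure M by fact
  note [measurable] = A borel_measurable_integrable[OF u]
  have int: "integrable M (\<lambda>s. q * (\<bar>u s\<bar> * indicator A s))"
    using u by (intro integrable_mult_right integrable_real_mult_indicator A) auto
  have "ennreal (\<integral>s. q * (\<bar>u s\<bar> * indicator A s) \<partial>M) = (\<integral>\<^sup>+ s. ennreal (q * (\<bar>u s\<bar> * indicator A s)) \<partial>M)"
    using int q by (intro nn_integral_eq_integral[symmetric]) auto
  also have "\<dots> \<le> (\<integral>\<^sup>+ s. ennreal c * indicator A s + \<psi> (u s) \<partial>M)"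
    using c(2) by (intro nn_integral_mono) (auto simp: indicator_def)
  also have "\<dots> = ennreal c * emeasure M A + (\<integral>\<^sup>+ s. \<psi> (u s) \<partial>M)"
    by (subst nn_integral_add) (auto simp: nn_integral_cmult_indicator)
  also have "\<dots> \<le> ennreal (c * measure M A + r)"
    using le c by (simp add: emeasure_eq_measure ennreal_mult[symmetric] ennreal_plus add_left_mono)
  finally have "ennreal (q * (\<integral>s. \<bar>u s\<bar> * indicator A s \<partial>M)) \<le> ennreal (c * measure M A + r)"
    by simp
  then show ?thesis using c le by (subst (asm) ennreal_le_iff) auto
qed


section \<open>Norm convergence in one coordinate\<close>

text \<open>Adding d on the right avoids the truncated subtraction of \<open>ennreal\<close>; this
  is why \<open>a < d\<close> is a separate case.\<close>

lemma eventually_less_add_of_le_Liminf: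
  fixes b :: "'j \<Rightarrow> ennreal"
  assumes "ennreal a \<le> Liminf F b" "0 < d"
  shows "\<forall>\<^sub>F j in F. ennreal a < b j + ennreal d"
proof (cases "a < d")
  case True
  then have "ennreal a < ennreal d" using assms(2) by (simp add: ennreal_lessI)
  then have "ennreal a < b j + ennreal d" for j
    by (rule order_less_le_trans) simp
  then show ?thesis by simp
next
  case False
  then have "ennreal (a - d) < ennreal a" using assms(2) by (intro ennreal_lessI) auto
  then have "\<forall>\<^sub>F j in F. ennreal (a - d) < b j" using assms(1) unfolding le_Liminf_iff by blast
  then show ?thesis
  proof eventually_elim
    case (elim j)
    show ?case
    proof (cases "b j")
      case (real r)
      then have "a - d < r" using elim False by (simp add: ennreal_less_iff)
      then have "ennreal a < ennreal (r + d)" using False assms(2) by (intro ennreal_lessI) auto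
      then show ?thesis using real assms(2) by (simp add: ennreal_plus)
    qed simp
  qed
qed

text \<open>An excess of x over A would have to be compensated by a deficit of z below R, which the
  lower bound on \<open>liminf z\<close> forbids.\<close>

lemma ennreal_tendsto_summand:
  fixes x z :: "nat \<Rightarrow> ennreal"
  assumes lim: "(\<lambda>n. x n + z n) \<longlonglongrightarrow> A + R" and fin: "A + R < \<infinity>"
    and le: "A \<le> liminf x" "R \<le> liminf z"
  shows "x \<longlonglongrightarrow> A"
proof (rule order_tendstoI)
  fix y assume "y < A"
  then show "\<forall>\<^sub>F n in sequentially. y < x n" using le(1) unfolding le_Liminf_iff by blast
next
  fix y assume y: "A < y"
  obtain \<alpha> where \<alpha>: "A = ennreal \<alpha>" "0 \<le> \<alpha>" using fin by (cases A) auto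
  obtain \<rho> where \<rho>: "R = ennreal \<rho>" "0 \<le> \<rho>" using fin by (cases R) auto
  obtain y' where y': "A < y'" "y' < y" using dense[OF y] by blast
  then obtain \<upsilon> where \<upsilon>: "y' = ennreal \<upsilon>" "0 \<le> \<upsilon>" by (cases y') auto
  \<comment> \<open>One half of the margin pays for the convergence of the sum, the other for the
    lower bound on z.\<close>
  define \<eta> where "\<eta> = (\<upsilon> - \<alpha>) / 2"
  have \<eta>: "0 < \<eta>" using y'(1) \<alpha> \<upsilon> by (simp add: \<eta>_def ennreal_less_iff)
  have "A + R < ennreal (\<alpha> + \<rho> + \<eta>)"
    using \<alpha> \<rho> \<eta> by (simp add: ennreal_plus[symmetric] ennreal_less_iff del: ennreal_plus)
  from order_tendstoD(2)[OF lim this]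
    eventually_less_add_of_le_Liminf[OF le(2)[unfolded \<rho>(1)] \<eta>]
  show "\<forall>\<^sub>F n in sequentially. x n < y"
  proof eventually_elim
    case (elim n)
    obtain \<xi> where \<xi>: "x n = ennreal \<xi>" "0 \<le> \<xi>" using elim(1) by (cases "x n") auto
    obtain \<zeta> where \<zeta>: "z n = ennreal \<zeta>" "0 \<le> \<zeta>" using elim(1) by (cases "z n") auto
    have "\<xi> + \<zeta> < \<alpha> + \<rho> + \<eta>"
      using elim(1) \<xi> \<zeta> by (simp add: ennreal_plus[symmetric] ennreal_less_iff del: ennreal_plus)
    moreover have "\<rho> < \<zeta> + \<eta>"
      using elim(2) \<zeta> \<eta> \<rho> by (simp add: ennreal_plus[symmetric] ennreal_less_iff del: ennreal_plus)
    ultimately have "\<xi> < \<upsilon>" by (simp add: \<eta>_def field_simps)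
    then have "x n < y'" using \<xi> \<upsilon> by (simp add: ennreal_less_iff)
    then show ?case using y'(2) by simp
  qed
qed

text \<open>Lets the Kadec argument pass from the convergence of the whole functional to that of
  each coordinate integral.\<close>

lemma ennreal_tendsto_summands:
  fixes a :: "'i \<Rightarrow> ennreal" and b :: "'i \<Rightarrow> nat \<Rightarrow> ennreal"
  assumes "finite I" and lim: "(\<lambda>n. \<Sum>i\<in>I. b i n) \<longlonglongrightarrow> (\<Sum>i\<in>I. a i)" and "(\<Sum>i\<in>I. a i) < \<infinity>"
    and le: "\<And>i. i \<in> I \<Longrightarrow> a i \<le> liminf (b i)" and i: "i \<in> I"
  shows "b i \<longlonglongrightarrow> a i"
proof (rule ennreal_tendsto_summand)
  show "(\<lambda>n. b i n + (\<Sum>i\<in>I - {i}. b i n)) \<longlonglongrightarrow> a i + (\<Sum>i\<in>I - {i}. a i)"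
    using lim by (simp add: sum.remove[OF assms(1) i])
  show "a i + (\<Sum>i\<in>I - {i}. a i) < \<infinity>"
    using assms(3) by (simp add: sum.remove[OF assms(1) i])
  have "(\<Sum>i\<in>I - {i}. a i) \<le> (\<Sum>i\<in>I - {i}. liminf (b i))" by (intro sum_mono le) auto
  also have "\<dots> \<le> liminf (\<lambda>n. \<Sum>i\<in>I - {i}. b i n)"
    using assms(1) by (intro ennreal_sum_Liminf_le) auto
  finally show "(\<Sum>i\<in>I - {i}. a i) \<le> liminf (\<lambda>n. \<Sum>i\<in>I - {i}. b i n)" .
qed (use le i in auto)

context superlinear_strictly_convex
begin

lemma integral_integrand:
  assumes [measurable]: "w \<in> borel_measurable M" and fin: "(\<integral>\<^sup>+ s. \<psi> (w s) \<partial>M) < \<infinity>"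
  shows "AE s in M. \<psi> (w s) < \<infinity>"
    and "integrable M (\<lambda>s. enn2real (\<psi> (w s)))"
    and "(\<integral>\<^sup>+ s. \<psi> (w s) \<partial>M) = ennreal (\<integral>s. enn2real (\<psi> (w s)) \<partial>M)"
proof -
  have "AE s in M. \<psi> (w s) \<noteq> \<infinity>" using fin by (intro nn_integral_PInf_AE) auto
  then show ae: "AE s in M. \<psi> (w s) < \<infinity>" by eventually_elim (simp add: less_top)
  have eq: "(\<integral>\<^sup>+ s. ennreal (enn2real (\<psi> (w s))) \<partial>M) = (\<integral>\<^sup>+ s. \<psi> (w s) \<partial>M)"
    using ae by (intro nn_integral_cong_AE) (auto elim!: eventually_mono)
  then show int: "integrable M (\<lambda>s. enn2real (\<psi> (w s)))"
    using fin by (intro integrableI_nonneg) auto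
  show "(\<integral>\<^sup>+ s. \<psi> (w s) \<partial>M) = ennreal (\<integral>s. enn2real (\<psi> (w s)) \<partial>M)"
    unfolding eq[symmetric] by (rule nn_integral_eq_integral[OF int]) simp
qed

text \<open>The midpoints also converge on sets to f, so their integrals are asymptotically at least
  that of \<open>\<psi> (f s)\<close>, while the averages of the end values tend to it. The
  nonnegative gap is squeezed between.\<close>

lemma midpoint_gap_integral_tendsto:
  assumes "finite_measure M" and v: "\<And>n. integrable M (v n)" and f: "integrable M f"
    and conv: "converges_on_sets M sequentially v f"
    and fin: "(\<integral>\<^sup>+ s. \<psi> (f s) \<partial>M) < \<infinity>" "\<And>n. (\<integral>\<^sup>+ s. \<psi> (v n s) \<partial>M) < \<infinity>"
    and lim: "(\<lambda>n. \<integral>s. enn2real (\<psi> (v n s)) \<partial>M) \<longlonglongrightarrow> (\<integral>s. enn2real (\<psi> (f s)) \<partial>M)"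
  shows "(\<lambda>n. \<integral>s. midpoint_gap (f s) (v n s) \<partial>M) \<longlonglongrightarrow> 0"
    and "integrable M (\<lambda>s. midpoint_gap (f s) (v n s))"
proof -
  define I where "I w = (\<integral>s. enn2real (\<psi> (w s)) \<partial>M)" for w
  define m where "m n s = (f s + v n s) / 2" for n s
  note [measurable] = borel_measurable_integrable[OF f] borel_measurable_integrable[OF v]
  have m: "integrable M (m n)" for n unfolding m_def[abs_def] using f v by simp
  note [measurable] = borel_measurable_integrable[OF m]
  have finm: "(\<integral>\<^sup>+ s. \<psi> (m n s) \<partial>M) < \<infinity>" for n
  proof -
    have "(\<integral>\<^sup>+ s. \<psi> (m n s) \<partial>M) \<le> (\<integral>\<^sup>+ s. \<psi> (f s) + \<psi> (v n s) \<partial>M)"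
    proof (rule nn_integral_mono)
      fix s
      have "\<psi> (m n s) \<le> ennreal (1 - 1/2) * \<psi> (f s) + ennreal (1/2) * \<psi> (v n s)"
        using convex[of "1/2" "f s" "v n s"] by (simp add: m_def add_divide_distrib)
      also have "\<dots> \<le> 1 * \<psi> (f s) + 1 * \<psi> (v n s)"
        by (intro add_mono mult_right_mono) (simp_all only: ennreal_le_1, simp_all)
      finally show "\<psi> (m n s) \<le> \<psi> (f s) + \<psi> (v n s)" by simp
    qed
    also have "\<dots> < \<infinity>" using fin by (subst nn_integral_add) auto
    finally show ?thesis .
  qed
  note If = integral_integrand[OF borel_measurable_integrable[OF f] fin(1)] and Iv = integral_integrand[OF borel_measurable_integrable[OF v] fin(2)]
    and Im = integral_integrand[OF borel_measurable_integrable[OF m] finm]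
  show int: "integrable M (\<lambda>s. midpoint_gap (f s) (v n s))" for n
    unfolding midpoint_gap_def m_def[symmetric] using If(2) Iv(2) Im(2) by simp
  have ID: "(\<integral>s. midpoint_gap (f s) (v n s) \<partial>M) = (I f + I (v n)) / 2 - I (m n)" for n
    unfolding midpoint_gap_def m_def[symmetric] I_def using If(2) Iv(2) Im(2) by simp
  have nonneg: "0 \<le> (\<integral>s. midpoint_gap (f s) (v n s) \<partial>M)" for n
  proof (rule integral_nonneg_AE)
    show "AE s in M. 0 \<le> midpoint_gap (f s) (v n s)"
      using If(1) Iv(1)[of n] by eventually_elim (rule midpoint_gap_nonneg)
  qed
  have "converges_on_sets M sequentially m f"
    unfolding converges_on_sets_def
  proof
    fix A assume A: "A \<in> sets M"
    have *: "(\<lambda>n. ((\<integral>s. f s * indicator A s \<partial>M) + (\<integral>s. v n s * indicator A s \<partial>M)) / 2)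
        \<longlonglongrightarrow> ((\<integral>s. f s * indicator A s \<partial>M) + (\<integral>s. f s * indicator A s \<partial>M)) / 2"
      using conv A by (intro tendsto_intros) (auto simp: converges_on_sets_def)
    have mA: "(\<integral>s. m n s * indicator A s \<partial>M) =
        ((\<integral>s. f s * indicator A s \<partial>M) + (\<integral>s. v n s * indicator A s \<partial>M)) / 2" for n
      using integrable_real_mult_indicator[OF A f] integrable_real_mult_indicator[OF A v[of n]]
      by (simp add: m_def distrib_right add_divide_distrib)
    show "(\<lambda>n. \<integral>s. m n s * indicator A s \<partial>M) \<longlonglongrightarrow> (\<integral>s. f s * indicator A s \<partial>M)"
      using * unfolding mA by simp
  qed
  then have "(\<integral>\<^sup>+ s. \<psi> (f s) \<partial>M) \<le> liminf (\<lambda>n. \<integral>\<^sup>+ s. \<psi> (m n s) \<partial>M)"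
    using m f by (intro nn_integral_le_Liminf assms(1)) auto
  then have liminf: "ennreal (I f) \<le> liminf (\<lambda>n. ennreal (I (m n)))"
    using If(3) Im(3) by (simp add: I_def)
  have Ipos: "0 \<le> I w" for w unfolding I_def by (intro integral_nonneg_AE) auto
  show "(\<lambda>n. \<integral>s. midpoint_gap (f s) (v n s) \<partial>M) \<longlonglongrightarrow> 0"
  proof (rule order_tendstoI)
    fix y :: real assume "y < 0"
    then show "\<forall>\<^sub>F n in sequentially. y < (\<integral>s. midpoint_gap (f s) (v n s) \<partial>M)"
      using nonneg by (intro always_eventually allI) (rule order_less_le_trans)
  next
    fix y :: real assume y: "0 < y"
    \<comment> \<open>The error at \<open>v n\<close> enters the gap halved, so y here and
      \<open>y / 2\<close> at the midpoints add up to y.\<close>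
    have "\<forall>\<^sub>F n in sequentially. I (v n) < I f + y"
      using order_tendstoD(2)[OF lim, of "I f + y"] y by (simp add: I_def)
    moreover have "\<forall>\<^sub>F n in sequentially. ennreal (I f) < ennreal (I (m n)) + ennreal (y / 2)"
      by (rule eventually_less_add_of_le_Liminf[OF liminf]) (use y in simp)
    ultimately show "\<forall>\<^sub>F n in sequentially. (\<integral>s. midpoint_gap (f s) (v n s) \<partial>M) < y"
    proof eventually_elim
      case (elim n)
      have "ennreal (I f) < ennreal (I (m n) + y / 2)" using elim(2) Ipos y by (simp add: ennreal_plus)
      then have "I f < I (m n) + y / 2" using Ipos by (simp add: ennreal_less_iff)
      then show ?case using elim(1) unfolding ID by (simp add: field_simps)
    qed
  qed
qed

text \<open>Fatou's lemma is applied to \<open>\<psi> (v n) + c + \<bar>f\<bar> - \<bar>v n - f\<bar>\<close>, which is nonnegative by superlinear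
  growth.\<close>

lemma L1_limit_if_AE_tendsto:
  assumes "finite_measure M" and v: "\<And>n. integrable M (v n)" and f: "integrable M f"
    and fin: "(\<integral>\<^sup>+ s. \<psi> (f s) \<partial>M) < \<infinity>" "\<And>n. (\<integral>\<^sup>+ s. \<psi> (v n s) \<partial>M) < \<infinity>"
    and lim: "(\<lambda>n. \<integral>s. enn2real (\<psi> (v n s)) \<partial>M) \<longlonglongrightarrow> (\<integral>s. enn2real (\<psi> (f s)) \<partial>M)"
    and ae: "AE s in M. (\<lambda>n. v n s) \<longlonglongrightarrow> f s"
    and e: "0 < e" "\<And>n. e \<le> (\<integral>s. \<bar>v n s - f s\<bar> \<partial>M)"
  shows False
proof -
  interpret finite_measure M by fact
  note [measurable] = borel_measurable_integrable[OF f] borel_measurable_integrable[OF v]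
  \<comment> \<open>Slope 1 is what makes \<open>\<psi> (v n s) + c\<close> dominate |v n s|, and
    then, with |f s| added, the distance of the two.\<close>
  obtain c where c: "0 \<le> c" "\<And>t. ennreal (1 * \<bar>t\<bar>) \<le> ennreal c + \<psi> t" using superlinear[of 1] by blast
  have c': "\<bar>t\<bar> \<le> c + enn2real (\<psi> t)" if t: "\<psi> t < \<infinity>" for t
  proof -
    obtain r where r: "\<psi> t = ennreal r" "0 \<le> r" using t by (cases "\<psi> t") auto
    have "ennreal \<bar>t\<bar> \<le> ennreal (c + r)" using c(2)[of t] c(1) r by (simp add: ennreal_plus)
    then show ?thesis using r c(1) by (subst (asm) ennreal_le_iff) auto
  qed
  define R where "R t = enn2real (\<psi> t)" for t
  have Rm [measurable]: "R \<in> borel_measurable borel" unfolding R_def[abs_def] by simp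
  define h where "h n s = R (v n s) + c + \<bar>f s\<bar> - \<bar>v n s - f s\<bar>" for n s
  have hm [measurable]: "h n \<in> borel_measurable M" for n unfolding h_def[abs_def] by simp
  note If = integral_integrand[OF borel_measurable_integrable[OF f] fin(1), folded R_def] and Iv = integral_integrand[OF borel_measurable_integrable[OF v] fin(2), folded R_def]
  have allfin: "AE s in M. \<forall>n. \<psi> (v n s) < \<infinity>" unfolding AE_all_countable using Iv(1) by simp
  have hint: "integrable M (h n)" for n
    unfolding h_def[abs_def] using Iv(2)[of n] f v by simp
  have h0: "AE s in M. 0 \<le> h n s" for n
    using allfin
  proof eventually_elim
    case (elim s)
    show ?case using c'[of "v n s"] elim unfolding h_def R_def by fastforce
  qed
  define T where "T = (\<integral>s. R (f s) \<partial>M) + c * measure M (space M) + (\<integral>s. \<bar>f s\<bar> \<partial>M)"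
  define T' where "T' n = (\<integral>s. R (v n s) \<partial>M) + c * measure M (space M) + (\<integral>s. \<bar>f s\<bar> \<partial>M)" for n
  \<comment> \<open>The assumed distance in norm appears as a deficit e in the integral of
    \<open>h n\<close>.\<close>
  have hle: "(\<integral>s. h n s \<partial>M) \<le> T' n - e" for n
    unfolding h_def T'_def using Iv(2)[of n] f v[of n] e(2)[of n] by (simp add: mult.commute)
  have T': "(\<lambda>n. T' n - e) \<longlonglongrightarrow> T - e"
    unfolding T'_def T_def using lim by (intro tendsto_intros) (simp add: R_def)
  have "0 \<le> T' n - e" for n
    using hle[of n] integral_nonneg_AE[OF h0[of n]] by linarith
  then have Te: "0 \<le> T - e" by (intro LIMSEQ_le_const[OF T']) auto
  \<comment> \<open>Pointwise, lower semicontinuity and the vanishing distance make the lower limit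
    of h at least the integrand of T. The deficit keeps the integrals of \<open>h n\<close> below a
    sequence tending to \<open>T - e\<close>, so Fatou gives \<open>T \<le> T - e\<close>.\<close>
  have "ennreal T = (\<integral>\<^sup>+ s. ennreal (R (f s) + c + \<bar>f s\<bar>) \<partial>M)"
  proof -
    have int: "integrable M (\<lambda>s. R (f s) + c + \<bar>f s\<bar>)" using If(2) f by simp
    have "(\<integral>s. R (f s) + c + \<bar>f s\<bar> \<partial>M) = T" unfolding T_def using If(2) f by (simp add: mult.commute)
    then show ?thesis using nn_integral_eq_integral[OF int] c(1) by (simp add: R_def)
  qed
  also have "\<dots> \<le> (\<integral>\<^sup>+ s. liminf (\<lambda>n. ennreal (h n s)) \<partial>M)"
  proof (rule nn_integral_mono_AE)
    show "AE s in M. ennreal (R (f s) + c + \<bar>f s\<bar>) \<le> liminf (\<lambda>n. ennreal (h n s))"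
      using ae allfin If(1)
    proof eventually_elim
      case (elim s)
      have "ennreal (R (f s)) \<le> liminf (\<lambda>n. ennreal (R (v n s)))"
        using integrand_liminf[OF elim(1)] elim(2,3) by (simp add: R_def)
      note ev = eventually_less_add_of_le_Liminf[OF this]
      show ?case
        unfolding le_Liminf_iff
      proof (intro allI impI)
        fix y assume y: "y < ennreal (R (f s) + c + \<bar>f s\<bar>)"
        then obtain r where r: "y = ennreal r" "0 \<le> r" by (cases y) auto
        define d where "d = (R (f s) + c + \<bar>f s\<bar>) - r"
        have d: "0 < d" using y r by (simp add: d_def ennreal_less_iff)
        have "\<forall>\<^sub>F n in sequentially. dist (v n s) (f s) < d / 2"
          by (rule tendstoD[OF elim(1)]) (use d in simp)
        with ev[OF half_gt_zero[OF d]] show "\<forall>\<^sub>F n in sequentially. y < ennreal (h n s)"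
        proof eventually_elim
          case (elim n)
          have R0: "0 \<le> R t" for t by (simp add: R_def)
          have "ennreal (R (f s)) < ennreal (R (v n s) + d / 2)" using elim(1) d R0 by (simp add: ennreal_plus)
          then have "R (f s) < R (v n s) + d / 2" using R0 by (simp add: ennreal_less_iff)
          then have "r < h n s" using elim(2) by (simp add: h_def d_def dist_real_def field_simps)
          then show ?case using r by (simp add: ennreal_lessI)
        qed
      qed
    qed
  qed
  also have "\<dots> \<le> liminf (\<lambda>n. \<integral>\<^sup>+ s. ennreal (h n s) \<partial>M)" by (rule nn_integral_liminf) simp
  also have "\<dots> \<le> liminf (\<lambda>n. ennreal (T' n - e))"
    using nn_integral_eq_integral[OF hint h0] hle
    by (intro Liminf_mono always_eventually) (simp add: ennreal_leI)
  also have "\<dots> = ennreal (T - e)"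
    by (intro lim_imp_Liminf tendsto_ennrealI T') simp
  finally have "T \<le> T - e" using Te by (subst (asm) ennreal_le_iff) auto
  then show False using e(1) by simp
qed

text \<open>Gaps tending to 0 in mean vanish almost everywhere only along a subsequence. Hence the
  detour by contradiction: one first passes to indices that stay at distance e in norm.\<close>

lemma L1_tendsto_if_converges_on_sets:
  assumes "finite_measure M" and u: "\<And>n. integrable M (u n)" and f: "integrable M f"
    and conv: "converges_on_sets M sequentially u f"
    and fin: "(\<integral>\<^sup>+ s. \<psi> (f s) \<partial>M) < \<infinity>"
    and lim: "(\<lambda>n. \<integral>\<^sup>+ s. \<psi> (u n s) \<partial>M) \<longlonglongrightarrow> (\<integral>\<^sup>+ s. \<psi> (f s) \<partial>M)"
  shows "(\<lambda>n. \<integral>s. \<bar>u n s - f s\<bar> \<partial>M) \<longlonglongrightarrow> 0"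
proof (rule ccontr)
  assume "\<not> ?thesis"
  then obtain e where e: "0 < e" "\<not> (\<forall>\<^sub>F n in sequentially. (\<integral>s. \<bar>u n s - f s\<bar> \<partial>M) < e)"
    unfolding tendsto_iff by (auto simp: dist_real_def)
  have evfin: "\<forall>\<^sub>F n in sequentially. (\<integral>\<^sup>+ s. \<psi> (u n s) \<partial>M) < \<infinity>"
    using order_tendstoD(2)[OF lim fin] .
  \<comment> \<open>Finiteness is built into S so that along the subsequence every integral, not
    just eventually every one, may be computed with real values.\<close>
  define S where "S = {n. e \<le> (\<integral>s. \<bar>u n s - f s\<bar> \<partial>M) \<and> (\<integral>\<^sup>+ s. \<psi> (u n s) \<partial>M) < \<infinity>}"
  have "infinite S"
  proof
    assume "finite S"
    then have "\<forall>\<^sub>F n in sequentially. n \<notin> S"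
      unfolding cofinite_eq_sequentially[symmetric] eventually_cofinite by simp
    with evfin have "\<forall>\<^sub>F n in sequentially. (\<integral>s. \<bar>u n s - f s\<bar> \<partial>M) < e"
      by eventually_elim (auto simp: S_def)
    with e(2) show False by blast
  qed
  from infinite_enumerate[OF this] obtain r :: "nat \<Rightarrow> nat" where r: "strict_mono r" "\<And>n. r n \<in> S"
    by auto
  note [measurable] = borel_measurable_integrable[OF f] borel_measurable_integrable[OF u]
  define v where "v n = u (r n)" for n
  have v: "integrable M (v n)" for n by (simp add: v_def u)
  have finv: "(\<integral>\<^sup>+ s. \<psi> (v n s) \<partial>M) < \<infinity>" and ev: "e \<le> (\<integral>s. \<bar>v n s - f s\<bar> \<partial>M)" for n
    using r(2)[of n] by (auto simp: S_def v_def)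
  have convv: "converges_on_sets M sequentially v f"
    using conv unfolding converges_on_sets_def v_def
    by (auto intro: LIMSEQ_subseq_LIMSEQ[OF _ r(1), unfolded comp_def])
  have "(\<lambda>n. \<integral>\<^sup>+ s. \<psi> (v n s) \<partial>M) \<longlonglongrightarrow> (\<integral>\<^sup>+ s. \<psi> (f s) \<partial>M)"
    using LIMSEQ_subseq_LIMSEQ[OF lim r(1)] by (simp add: comp_def v_def)
  then have "(\<lambda>n. ennreal (\<integral>s. enn2real (\<psi> (v n s)) \<partial>M)) \<longlonglongrightarrow> ennreal (\<integral>s. enn2real (\<psi> (f s)) \<partial>M)"
    using integral_integrand(3)[OF borel_measurable_integrable[OF f] fin] integral_integrand(3)[OF borel_measurable_integrable[OF v] finv] by simp
  then have limv: "(\<lambda>n. \<integral>s. enn2real (\<psi> (v n s)) \<partial>M) \<longlonglongrightarrow> (\<integral>s. enn2real (\<psi> (f s)) \<partial>M)"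
    by (rule tendsto_ennrealD) (auto intro!: always_eventually integral_nonneg_AE)
  note gap = midpoint_gap_integral_tendsto[OF assms(1) v f convv fin finv limv]
  have finAE: "AE s in M. \<psi> (f s) < \<infinity>" "AE s in M. \<forall>n. \<psi> (v n s) < \<infinity>"
    unfolding AE_all_countable
    using integral_integrand(1)[OF borel_measurable_integrable[OF f] fin] integral_integrand(1)[OF borel_measurable_integrable[OF v] finv] by auto
  have "AE s in M. norm (midpoint_gap (f s) (v n s)) = midpoint_gap (f s) (v n s)" for n
    using finAE by eventually_elim (simp add: midpoint_gap_nonneg)
  then have "(\<integral>s. norm (midpoint_gap (f s) (v n s)) \<partial>M) = (\<integral>s. midpoint_gap (f s) (v n s) \<partial>M)" for n
    using borel_measurable_integrable[OF gap(2)[of n]] by (intro integral_cong_AE) auto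
  then have "(\<lambda>n. \<integral>s. norm (midpoint_gap (f s) (v n s)) \<partial>M) \<longlonglongrightarrow> 0" using gap(1) by simp
  from tendsto_L1_AE_subseq[OF gap(2) this] obtain q
    where q: "strict_mono q" "AE s in M. (\<lambda>n. midpoint_gap (f s) (v (q n) s)) \<longlonglongrightarrow> 0" by blast
  have ae: "AE s in M. (\<lambda>n. v (q n) s) \<longlonglongrightarrow> f s"
    using finAE q(2)
  proof eventually_elim
    case (elim s)
    show ?case by (rule midpoint_gap_tendsto_imp[OF elim(1) _ elim(3)]) (use elim(2) in blast)
  qed
  have limq: "(\<lambda>n. \<integral>s. enn2real (\<psi> (v (q n) s)) \<partial>M) \<longlonglongrightarrow> (\<integral>s. enn2real (\<psi> (f s)) \<partial>M)"
    using LIMSEQ_subseq_LIMSEQ[OF limv q(1)] by (simp add: comp_def)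
  show False
    by (rule L1_limit_if_AE_tendsto[OF assms(1) v f fin finv limq ae e(1) ev])
qed

end


section \<open>Separable integral functionals\<close>

text \<open>A sum of integrals, so that the results on the line apply to each summand;
  \<open>integral_functional_eq_separable_integral\<close> identifies it with the integral
  functional up to a constant.\<close>

definition separable_integral :: "'s measure \<Rightarrow> ('d::finite \<Rightarrow> real \<Rightarrow> ennreal) \<Rightarrow> ('s \<Rightarrow> real ^ 'd) \<Rightarrow> ennreal" where
  "separable_integral M \<psi> f = (\<Sum>i\<in>UNIV. \<integral>\<^sup>+ s. \<psi> i (f s $ i) \<partial>M)"

lemma separable_integral_cong_AE:
  assumes "AE s in M. f s = g s"
  shows "separable_integral M \<psi> f = separable_integral M \<psi> g"
  unfolding separable_integral_def
proof (intro sum.cong refl nn_integral_cong_AE)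
  fix i show "AE s in M. \<psi> i (f s $ i) = \<psi> i (g s $ i)"
    using assms by eventually_elim simp
qed

text \<open>A Dunford-Pettis argument for filters: the growth estimate bounds the integrals over
  sets for Tychonoff and makes their limits absolutely continuous.\<close>

lemma compactin_separable_integral_level_set:
  fixes \<psi> :: "'d::finite \<Rightarrow> real \<Rightarrow> ennreal"
  assumes "finite_measure M" and \<psi>: "\<And>i. superlinear_strictly_convex (\<psi> i)" and r: "0 \<le> r"
  shows "compactin (weak_topology (L1 M))
    {x \<in> points (L1 M). separable_integral M \<psi> (L1_rep x) \<le> ennreal r}" (is "compactin _ ?K")
proof (rule compactin_weak_topologyI)
  interpret finite_measure M by fact
  fix F assume F: "F \<noteq> bot" "\<forall>\<^sub>F x in F. x \<in> ?K"
  have rep: "integrable M (L1_rep x)" "integrable M (\<lambda>s. L1_rep x s $ i)" if "x \<in> ?K" for x i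
    using that L1_class_L1_rep(1)[of x M] by (auto intro: integrable_vec_nth)
  have N_le: "(\<integral>\<^sup>+ s. \<psi> i (L1_rep x s $ i) \<partial>M) \<le> ennreal r" if "x \<in> ?K" for x i
  proof -
    have "(\<integral>\<^sup>+ s. \<psi> i (L1_rep x s $ i) \<partial>M) \<le> separable_integral M \<psi> (L1_rep x)"
      unfolding separable_integral_def by (rule member_le_sum) auto
    also have "\<dots> \<le> ennreal r" using that by simp
    finally show ?thesis .
  qed
  have bound: "\<exists>c\<ge>0. \<forall>x\<in>?K. \<forall>A\<in>sets M. q * (\<integral>s. \<bar>L1_rep x s $ i\<bar> * indicator A s \<partial>M) \<le> c * measure M A + r"
    if q: "0 \<le> q" for q i
  proof -
    obtain c where c: "0 \<le> c" "\<And>t. ennreal (q * \<bar>t\<bar>) \<le> ennreal c + \<psi> i t"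
      using superlinear_strictly_convex.superlinear[OF \<psi>] by blast
    show ?thesis
      using superlinear_strictly_convex.integral_on_set_le[OF \<psi> assms(1) rep(2) N_le r c q] c(1) by blast
  qed
  have "\<exists>c. \<forall>i. \<forall>x\<in>?K. \<forall>A\<in>sets M. (\<integral>s. \<bar>L1_rep x s $ i\<bar> * indicator A s \<partial>M) \<le> c i * measure M A + r"
    using bound[of 1] by (intro choice) fastforce
  then obtain c where c: "\<And>i x A. x \<in> ?K \<Longrightarrow> A \<in> sets M \<Longrightarrow>
      (\<integral>s. \<bar>L1_rep x s $ i\<bar> * indicator A s \<partial>M) \<le> c i * measure M A + r" by blast
  define part where "part b t = max 0 (if b then t else - t)" for b and t :: real
  have part_le: "part b t \<le> \<bar>t\<bar>" "0 \<le> part b t" for b t by (auto simp: part_def)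
  have part_meas [measurable]: "part b \<in> borel_measurable borel" for b unfolding part_def by simp
  have part_int: "integrable M (\<lambda>s. part b (v s))" if "integrable M v" for b v
    using that by (cases b) (auto simp: part_def)
  \<comment> \<open>The index combines sign, coordinate and set. The value 0 at sets that are not
    measurable keeps the family bounded over the whole index type.\<close>
  define \<Phi> where "\<Phi> x = (\<lambda>(b, i, A). if A \<in> sets M then \<integral>s. part b (L1_rep x s $ i) * indicator A s \<partial>M else 0)"
    for x :: "('a \<Rightarrow> real ^ 'd) set"
  have \<Phi>_nonneg: "0 \<le> \<Phi> x (b, i, A)" for x b i A
    unfolding \<Phi>_def using part_le(2) by (auto intro!: integral_nonneg_AE)
  have \<Phi>_le: "\<Phi> x (b, i, A) \<le> (\<integral>s. \<bar>L1_rep x s $ i\<bar> * indicator A s \<partial>M)" if "x \<in> ?K" "A \<in> sets M" for x b i A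
    unfolding \<Phi>_def using that(2) rep(2)[OF that(1)] part_le
    by (auto intro!: integral_mono integrable_real_mult_indicator part_int mult_right_mono)
  have "\<exists>G p. G \<le> F \<and> G \<noteq> bot \<and> (\<forall>j. ((\<lambda>x. \<Phi> x j) \<longlongrightarrow> p j) G)"
  proof (rule cluster_filter_bounded_functions[OF F(1)])
    show "\<forall>\<^sub>F x in F. \<forall>j. \<bar>\<Phi> x j\<bar> \<le> (case j of (b, i, A) \<Rightarrow> \<bar>c i * measure M A + r\<bar>)"
      using F(2)
    proof eventually_elim
      case (elim x)
      show ?case
      proof (clarify)
        fix b i A
        show "\<bar>\<Phi> x (b, i, A)\<bar> \<le> \<bar>c i * measure M A + r\<bar>"
        proof (cases "A \<in> sets M")
          case True
          then show ?thesis using \<Phi>_le[OF elim True, of b i] c[OF elim True, of i] \<Phi>_nonneg[of x b i A] by linarith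
        qed (simp add: \<Phi>_def)
      qed
    qed
  qed
  then obtain G p where G: "G \<le> F" "G \<noteq> bot" and p: "\<And>j. ((\<lambda>x. \<Phi> x j) \<longlongrightarrow> p j) G" by blast
  have inK: "\<forall>\<^sub>F x in G. x \<in> ?K" using filter_leD[OF G(1) F(2)] .
  have "\<exists>h. integrable M h \<and> (\<forall>s. 0 \<le> h s) \<and> (\<forall>A\<in>sets M. p (b, i, A) = (\<integral>s. h s * indicator A s \<partial>M))" for b i
  proof (rule density_of_set_function)
    fix A show "0 \<le> p (b, i, A)"
      by (rule tendsto_lowerbound[OF p _ G(2)]) (simp add: \<Phi>_nonneg)
  next
    fix A B assume AB: "A \<in> sets M" "B \<in> sets M" "A \<inter> B = {}"
    have "\<forall>\<^sub>F x in G. \<Phi> x (b, i, A \<union> B) = \<Phi> x (b, i, A) + \<Phi> x (b, i, B)"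
      using inK
    proof eventually_elim
      case (elim x)
      have "part b (L1_rep x s $ i) * indicator (A \<union> B) s =
          part b (L1_rep x s $ i) * indicator A s + part b (L1_rep x s $ i) * indicator B s" for s
        using AB(3) by (auto simp: indicator_def)
      then show ?case
        using AB integrable_real_mult_indicator[OF AB(1) part_int[OF rep(2)[OF elim]]]
          integrable_real_mult_indicator[OF AB(2) part_int[OF rep(2)[OF elim]]]
        by (simp add: \<Phi>_def)
    qed
    then have "((\<lambda>x. \<Phi> x (b, i, A \<union> B)) \<longlongrightarrow> p (b, i, A) + p (b, i, B)) G"
      using tendsto_add[OF p p] by (rule tendsto_cong[THEN iffD2])
    then show "p (b, i, A \<union> B) = p (b, i, A) + p (b, i, B)"
      using tendsto_unique[OF G(2) p] by blast
  next
    fix e :: real assume e: "0 < e"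
    \<comment> \<open>With slope q, the growth estimate divided by q drops below e once k times the
      measure of A is less than 1; measure below \<open>1 / (k + 1)\<close> ensures this, also for k
      equal to 0.\<close>
    define q where "q = (r + 1) / e"
    have q: "0 < q" "q * e = r + 1" using e r by (simp_all add: q_def)
    obtain k where k: "0 \<le> k" "\<And>x A. x \<in> ?K \<Longrightarrow> A \<in> sets M \<Longrightarrow>
        q * (\<integral>s. \<bar>L1_rep x s $ i\<bar> * indicator A s \<partial>M) \<le> k * measure M A + r"
      using bound[of q i] q(1) by auto
    have "p (b, i, A) < e" if A: "A \<in> sets M" "measure M A < 1 / (k + 1)" for A
    proof -
      have "\<forall>\<^sub>F x in G. \<Phi> x (b, i, A) \<le> (k * measure M A + r) / q"
        using inK
      proof eventually_elim
        case (elim x)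
        have "q * \<Phi> x (b, i, A) \<le> q * (\<integral>s. \<bar>L1_rep x s $ i\<bar> * indicator A s \<partial>M)"
          using \<Phi>_le[OF elim A(1)] q(1) by (intro mult_left_mono) auto
        also have "\<dots> \<le> k * measure M A + r" by (rule k(2)[OF elim A(1)])
        finally show ?case using q(1) by (simp add: field_simps)
      qed
      then have "p (b, i, A) \<le> (k * measure M A + r) / q" by (rule tendsto_upperbound[OF p _ G(2)])
      also have "\<dots> < e"
      proof -
        have "k * measure M A \<le> k * (1 / (k + 1))" using A(2) k(1) by (intro mult_left_mono) auto
        also have "\<dots> < 1" using k(1) by simp
        finally have "k * measure M A + r < q * e" using q(2) by simp
        then show ?thesis using q(1) by (simp add: field_simps)
      qed
      finally show ?thesis .
    qed
    then show "\<exists>d>0. \<forall>A\<in>sets M. measure M A < d \<longrightarrow> p (b, i, A) < e"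
      using k(1) by (intro exI[of _ "1 / (k + 1)"]) auto
  qed
  then obtain h where h: "\<And>b i. integrable M (h b i)"
      "\<And>b i A. A \<in> sets M \<Longrightarrow> p (b, i, A) = (\<integral>s. h b i s * indicator A s \<partial>M)" by metis
  \<comment> \<open>The two limits need not be the positive and negative parts of f, as they may
    overlap; only their difference matters.\<close>
  define f where "f s = (\<chi> i. h True i s - h False i s)" for s
  have f: "integrable M f" unfolding f_def by (intro integrable_vec_lambda Bochner_Integration.integrable_diff h(1))
  have conv: "converges_on_sets M G (\<lambda>x s. L1_rep x s $ i) (\<lambda>s. f s $ i)" for i
    unfolding converges_on_sets_def
  proof
    fix A assume A: "A \<in> sets M"
    have lim: "((\<lambda>x. \<Phi> x (True, i, A) - \<Phi> x (False, i, A)) \<longlongrightarrow> p (True, i, A) - p (False, i, A)) G"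
      by (intro tendsto_diff p)
    have "\<forall>\<^sub>F x in G. (\<integral>s. L1_rep x s $ i * indicator A s \<partial>M) = \<Phi> x (True, i, A) - \<Phi> x (False, i, A)"
      using inK
    proof eventually_elim
      case (elim x)
      have split: "t = part True t - part False t" for t by (simp add: part_def)
      have "(\<integral>s. L1_rep x s $ i * indicator A s \<partial>M) =
          (\<integral>s. part True (L1_rep x s $ i) * indicator A s - part False (L1_rep x s $ i) * indicator A s \<partial>M)"
        by (subst (1) split) (simp only: left_diff_distrib)
      then show ?case
        using A Bochner_Integration.integral_diff[OF
            integrable_real_mult_indicator[OF A part_int[OF rep(2)[OF elim]]]
            integrable_real_mult_indicator[OF A part_int[OF rep(2)[OF elim]]], of True i False i]
        by (simp add: \<Phi>_def)
    qed
    moreover have "p (True, i, A) - p (False, i, A) = (\<integral>s. f s $ i * indicator A s \<partial>M)"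
      using h(2)[OF A] integrable_real_mult_indicator[OF A h(1)] by (simp add: f_def left_diff_distrib)
    ultimately show "((\<lambda>x. \<integral>s. L1_rep x s $ i * indicator A s \<partial>M) \<longlongrightarrow> (\<integral>s. f s $ i * indicator A s \<partial>M)) G"
      using lim tendsto_cong by fastforce
  qed
  have evint: "\<forall>\<^sub>F x in G. integrable M (\<lambda>s. L1_rep x s $ i)" for i
    using inK by eventually_elim (rule rep(2))
  have "separable_integral M \<psi> f \<le> (\<Sum>i\<in>UNIV. Liminf G (\<lambda>x. \<integral>\<^sup>+ s. \<psi> i (L1_rep x s $ i) \<partial>M))"
    unfolding separable_integral_def
    by (intro sum_mono superlinear_strictly_convex.nn_integral_le_Liminf[OF \<psi> assms(1)] evint conv integrable_vec_nth f)
  also have "\<dots> \<le> Liminf G (\<lambda>x. separable_integral M \<psi> (L1_rep x))"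
    unfolding separable_integral_def using G(2) by (intro ennreal_sum_Liminf_le) auto
  also have "\<dots> \<le> ennreal r"
    using inK by (intro Liminf_le[OF G(2)]) (auto elim: eventually_mono)
  finally have "separable_integral M \<psi> (L1_rep (L1_class M f)) \<le> ennreal r"
    using separable_integral_cong_AE[OF L1_rep_class(2)[OF f]] by simp
  then have "L1_class M f \<in> ?K" using L1_class_in_points[OF f] by simp
  moreover have "(l \<longlongrightarrow> l (L1_class M f)) G" if l: "l \<in> dual_space (L1 M)" for l
  proof -
    obtain B g where g: "\<And>i. g i \<in> borel_measurable M" "\<And>i s. \<bar>g i s\<bar> \<le> B"
        "\<And>f. integrable M f \<Longrightarrow> l (L1_class M f) = (\<Sum>i\<in>UNIV. \<integral>s. f s $ i * g i s \<partial>M)"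
      using dual_space_L1_density[OF l] by blast
    \<comment> \<open>The norm bound needed to pass from sets to bounded densities is the slope-1
      estimate taken on the whole space.\<close>
    have "((\<lambda>x. \<integral>s. L1_rep x s $ i * g i s \<partial>M) \<longlongrightarrow> (\<integral>s. f s $ i * g i s \<partial>M)) G" for i
    proof (rule converges_on_sets_imp_weak[OF _ integrable_vec_nth[OF f] conv g(1,2)])
      show "\<forall>\<^sub>F x in G. integrable M (\<lambda>s. L1_rep x s $ i) \<and>
          (\<integral>s. \<bar>L1_rep x s $ i\<bar> \<partial>M) \<le> c i * measure M (space M) + r"
        using inK
      proof eventually_elim
        case (elim x)
        have "(\<integral>s. \<bar>L1_rep x s $ i\<bar> \<partial>M) = (\<integral>s. \<bar>L1_rep x s $ i\<bar> * indicator (space M) s \<partial>M)"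
          by (intro Bochner_Integration.integral_cong) auto
        then show ?case using c[OF elim sets.top, of i] rep(2)[OF elim] by simp
      qed
    qed
    then have "((\<lambda>x. \<Sum>i\<in>UNIV. \<integral>s. L1_rep x s $ i * g i s \<partial>M) \<longlongrightarrow> l (L1_class M f)) G"
      unfolding g(3)[OF f] by (intro tendsto_sum)
    moreover have "\<forall>\<^sub>F x in G. l x = (\<Sum>i\<in>UNIV. \<integral>s. L1_rep x s $ i * g i s \<partial>M)"
      using inK
    proof eventually_elim
      case (elim x)
      then show ?case using g(3)[OF rep(1)[OF elim]] L1_class_L1_rep(2)[of x M] by simp
    qed
    ultimately show ?thesis by (rule tendsto_cong[THEN iffD2, rotated])
  qed
  ultimately show "\<exists>G x. G \<le> F \<and> G \<noteq> bot \<and> x \<in> ?K \<and> (\<forall>l\<in>dual_space (L1 M). (l \<longlongrightarrow> l x) G)"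
    using G by blast
qed auto

section \<open>Strict convexity of the integrals and removal of the additive constant\<close>

context superlinear_strictly_convex
begin

lemma nn_integral_convex:
  assumes [measurable]: "u \<in> borel_measurable M" "w \<in> borel_measurable M" and "0 < t" "t < 1"
  shows "(\<integral>\<^sup>+ s. \<psi> ((1 - t) * u s + t * w s) \<partial>M) \<le>
    ennreal (1 - t) * (\<integral>\<^sup>+ s. \<psi> (u s) \<partial>M) + ennreal t * (\<integral>\<^sup>+ s. \<psi> (w s) \<partial>M)"
proof -
  have "(\<integral>\<^sup>+ s. \<psi> ((1 - t) * u s + t * w s) \<partial>M) \<le>
      (\<integral>\<^sup>+ s. ennreal (1 - t) * \<psi> (u s) + ennreal t * \<psi> (w s) \<partial>M)"
    using assms by (intro nn_integral_mono convex) auto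
  then show ?thesis by (simp add: nn_integral_add nn_integral_cmult)
qed

text \<open>With a finite left-hand integral, equality would force equality almost everywhere in the
  pointwise inequality, which strict convexity permits only where u and w agree.\<close>

lemma nn_integral_strictly_convex:
  assumes [measurable]: "u \<in> borel_measurable M" "w \<in> borel_measurable M" and t: "0 < t" "t < 1"
    and fin: "(\<integral>\<^sup>+ s. \<psi> (u s) \<partial>M) < \<infinity>" "(\<integral>\<^sup>+ s. \<psi> (w s) \<partial>M) < \<infinity>"
    and ne: "\<not> (AE s in M. u s = w s)"
  shows "(\<integral>\<^sup>+ s. \<psi> ((1 - t) * u s + t * w s) \<partial>M) <
    ennreal (1 - t) * (\<integral>\<^sup>+ s. \<psi> (u s) \<partial>M) + ennreal t * (\<integral>\<^sup>+ s. \<psi> (w s) \<partial>M)"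
proof -
  have "ennreal (1 - t) * (\<integral>\<^sup>+ s. \<psi> (u s) \<partial>M) + ennreal t * (\<integral>\<^sup>+ s. \<psi> (w s) \<partial>M) < \<infinity>"
    using fin by (simp add: ennreal_mult_less_top)
  then have "(\<integral>\<^sup>+ s. \<psi> ((1 - t) * u s + t * w s) \<partial>M) \<noteq> \<infinity>"
    using order_le_less_trans[OF nn_integral_convex[OF assms(1-4)]] by (metis less_irrefl)
  then have "(\<integral>\<^sup>+ s. \<psi> ((1 - t) * u s + t * w s) \<partial>M) <
      (\<integral>\<^sup>+ s. ennreal (1 - t) * \<psi> (u s) + ennreal t * \<psi> (w s) \<partial>M)"
  proof (rule nn_integral_less[rotated 2])
    show "AE s in M. \<psi> ((1 - t) * u s + t * w s) \<le> ennreal (1 - t) * \<psi> (u s) + ennreal t * \<psi> (w s)"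
      using t by (intro AE_I2 convex) auto
    show "\<not> (AE s in M. ennreal (1 - t) * \<psi> (u s) + ennreal t * \<psi> (w s) \<le> \<psi> ((1 - t) * u s + t * w s))"
    proof
      assume "AE s in M. ennreal (1 - t) * \<psi> (u s) + ennreal t * \<psi> (w s) \<le> \<psi> ((1 - t) * u s + t * w s)"
      with integral_integrand(1)[OF assms(1) fin(1)] integral_integrand(1)[OF assms(2) fin(2)]
      have "AE s in M. u s = w s"
      proof eventually_elim
        case (elim s)
        show ?case
        proof (rule ccontr)
          assume "u s \<noteq> w s"
          from strictly_convex[OF elim(1,2) this t] elim(3) show False by simp
        qed
      qed
      with ne show False ..
    qed
  qed simp_all
  then show ?thesis by (simp add: nn_integral_add nn_integral_cmult)
qed

end

lemma separable_integral_strictly_convex: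
  fixes \<psi> :: "'d::finite \<Rightarrow> real \<Rightarrow> ennreal"
  assumes \<psi>: "\<And>i. superlinear_strictly_convex (\<psi> i)"
    and u: "u \<in> borel_measurable M" and w: "w \<in> borel_measurable M" and t: "0 < t" "t < 1"
    and fin: "separable_integral M \<psi> u < \<infinity>" "separable_integral M \<psi> w < \<infinity>"
    and ne: "\<not> (AE s in M. u s = w s)"
  shows "separable_integral M \<psi> (\<lambda>s. (1 - t) *\<^sub>R u s + t *\<^sub>R w s) <
    ennreal (1 - t) * separable_integral M \<psi> u + ennreal t * separable_integral M \<psi> w"
proof -
  have meas: "(\<lambda>s. u s $ i) \<in> borel_measurable M" "(\<lambda>s. w s $ i) \<in> borel_measurable M" for i
  proof -
    have "(\<lambda>z :: real ^ 'd. z $ i) \<in> borel_measurable borel"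
      by (intro borel_measurable_continuous_onI continuous_intros)
    then show "(\<lambda>s. u s $ i) \<in> borel_measurable M" "(\<lambda>s. w s $ i) \<in> borel_measurable M"
      using measurable_compose[OF u] measurable_compose[OF w] by blast+
  qed
  define a where "a i = (\<integral>\<^sup>+ s. \<psi> i (u s $ i) \<partial>M)" for i
  define b where "b i = (\<integral>\<^sup>+ s. \<psi> i (w s $ i) \<partial>M)" for i
  define m where "m i = (\<integral>\<^sup>+ s. \<psi> i ((1 - t) * (u s $ i) + t * (w s $ i)) \<partial>M)" for i
  have ab: "a i < \<infinity>" "b i < \<infinity>" for i
    using fin unfolding separable_integral_def a_def b_def by simp_all
  have "\<exists>i. \<not> (AE s in M. u s $ i = w s $ i)"
  proof (rule ccontr)
    assume "\<not> ?thesis"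
    then have "AE s in M. \<forall>i\<in>UNIV. u s $ i = w s $ i"
      by (intro AE_finite_allI) auto
    then have "AE s in M. u s = w s" by eventually_elim (simp add: vec_eq_iff)
    with ne show False ..
  qed
  then obtain i where i: "\<not> (AE s in M. u s $ i = w s $ i)" by blast
  have lt: "m i < ennreal (1 - t) * a i + ennreal t * b i"
    unfolding m_def a_def b_def
    using ab[unfolded a_def b_def]
    by (intro superlinear_strictly_convex.nn_integral_strictly_convex[OF \<psi> meas t _ _ i])
  have le: "m j \<le> ennreal (1 - t) * a j + ennreal t * b j" for j
    unfolding m_def a_def b_def by (intro superlinear_strictly_convex.nn_integral_convex[OF \<psi> meas t])
  let ?J = "UNIV - {i}"
  \<comment> \<open>Adding the remaining coordinates preserves the strict inequality of coordinate i
    in \<open>ennreal\<close> only because they are finite.\<close>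
  have "(\<Sum>j\<in>?J. ennreal (1 - t) * a j + ennreal t * b j) < \<infinity>"
    using ab by (simp add: ennreal_mult_less_top)
  then have "m i + (\<Sum>j\<in>?J. ennreal (1 - t) * a j + ennreal t * b j) <
      (ennreal (1 - t) * a i + ennreal t * b i) + (\<Sum>j\<in>?J. ennreal (1 - t) * a j + ennreal t * b j)"
    using lt by (subst (1 2) add.commute) (simp add: ennreal_add_left_cancel_less less_top)
  then have "m i + (\<Sum>j\<in>?J. m j) <
      (ennreal (1 - t) * a i + ennreal t * b i) + (\<Sum>j\<in>?J. ennreal (1 - t) * a j + ennreal t * b j)"
    by (rule order_le_less_trans[rotated]) (intro add_left_mono sum_mono le)
  then have "(\<Sum>j\<in>UNIV. m j) < (\<Sum>j\<in>UNIV. ennreal (1 - t) * a j + ennreal t * b j)"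
    by (simp add: sum.remove[of UNIV i])
  then show ?thesis
    by (simp add: separable_integral_def a_def b_def m_def sum.distrib sum_distrib_left)
qed

text \<open>The positive and negative parts of k - c are the truncated differences k - c and c - k,
  tied by (k - c) + c = k + (c - k). The second is at most c, so its integral is finite and
  \<infinity> - \<infinity> never occurs.\<close>

lemma ereal_integral_shift:
  assumes "finite_measure M" and [measurable]: "k \<in> borel_measurable M" and c: "0 \<le> c"
  shows "ereal_integral M (\<lambda>s. enn2ereal (k s) - ereal c) =
    enn2ereal (\<integral>\<^sup>+ s. k s \<partial>M) - ereal (c * measure M (space M))"
proof -
  interpret finite_measure M by fact
  have pos: "e2ennreal (enn2ereal x - ereal c) = x - ennreal c" for x
    using c by (cases x) (auto simp: enn2ereal_ennreal ennreal_minus)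
  have neg: "e2ennreal (- (enn2ereal x - ereal c)) = ennreal c - x" for x
    using c by (cases x) (auto simp: enn2ereal_ennreal ennreal_minus e2ennreal_neg)
  have swap: "(x - ennreal c) + ennreal c = x + (ennreal c - x)" for x
  proof (cases x)
    case (real a)
    then show ?thesis using c
      by (cases "a \<le> c") (auto simp: ennreal_minus ennreal_plus[symmetric] ennreal_neg simp del: ennreal_plus)
  qed simp
  define P where "P = (\<integral>\<^sup>+ s. k s - ennreal c \<partial>M)"
  define Q where "Q = (\<integral>\<^sup>+ s. ennreal c - k s \<partial>M)"
  define W where "W = (\<integral>\<^sup>+ s. k s \<partial>M)"
  have cM: "(\<integral>\<^sup>+ s. ennreal c \<partial>M) = ennreal (c * measure M (space M))"
    using c by (simp add: emeasure_eq_measure ennreal_mult)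
  have "P + (\<integral>\<^sup>+ s. ennreal c \<partial>M) = (\<integral>\<^sup>+ s. (k s - ennreal c) + ennreal c \<partial>M)"
    unfolding P_def by (rule nn_integral_add[symmetric]) auto
  also have "\<dots> = W + Q"
    unfolding swap W_def Q_def by (rule nn_integral_add) auto
  finally have "P + (\<integral>\<^sup>+ s. ennreal c \<partial>M) = W + Q" .
  then have eq: "P + ennreal (c * measure M (space M)) = W + Q" unfolding cM .
  have "Q \<le> (\<integral>\<^sup>+ s. ennreal c \<partial>M)" unfolding Q_def by (intro nn_integral_mono) (simp add: diff_le_self_ennreal)
  then have "Q < \<infinity>" unfolding cM using order_le_less_trans by fastforce
  then obtain q where q: "Q = ennreal q" "0 \<le> q" by (cases Q) auto
  have d: "0 \<le> c * measure M (space M)" using c by simp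
  have "enn2ereal P - enn2ereal Q = enn2ereal W - ereal (c * measure M (space M))"
  proof (cases P)
    case (real x)
    then have "W + Q < \<infinity>" using eq[symmetric] by simp
    then obtain y where y: "W = ennreal y" "0 \<le> y" by (cases W) auto
    have "x + c * measure M (space M) = y + q"
      using eq d real y q by (simp add: ennreal_plus[symmetric] del: ennreal_plus)
    then show ?thesis using real y q by (simp add: enn2ereal_ennreal)
  next
    case top
    then have "W + ennreal q = \<infinity>" using eq q(1) by simp
    then have "W = \<infinity>" by (simp add: ennreal_add_eq_top)
    then show ?thesis using top q by (simp add: enn2ereal_ennreal)
  qed
  then show ?thesis by (simp add: ereal_integral_def pos neg P_def Q_def W_def)
qed

lemma integral_functional_eq_separable_integral:
  fixes \<psi> :: "'d::finite \<Rightarrow> real \<Rightarrow> ennreal"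
  assumes "finite_measure M" and \<psi>: "\<And>i. superlinear_strictly_convex (\<psi> i)"
    and c: "\<And>i. 0 \<le> c i" and \<phi>: "\<And>z. \<phi> z = (\<Sum>i\<in>UNIV. enn2ereal (\<psi> i (z $ i)) - ereal (c i))"
    and f: "integrable M f"
  shows "integral_functional M \<phi> (L1_class M f) =
    enn2ereal (separable_integral M \<psi> f) - ereal ((\<Sum>i\<in>UNIV. c i) * measure M (space M))"
proof -
  have add: "(enn2ereal x - ereal a) + (enn2ereal y - ereal b) = enn2ereal (x + y) - ereal (a + b)" for x y a b
    by (cases x; cases y) (auto simp: enn2ereal_ennreal plus_ennreal.rep_eq)
  have sum: "(\<Sum>i\<in>I. enn2ereal (x i) - ereal (c i)) = enn2ereal (\<Sum>i\<in>I. x i) - ereal (\<Sum>i\<in>I. c i)"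
    if "finite I" for I and x :: "'d \<Rightarrow> ennreal"
    using that
  proof (induction I)
    case (insert i I)
    then show ?case using add[of "x i" "c i"] by simp
  qed (simp add: zero_ennreal.rep_eq)
  have meas: "(\<lambda>s. \<psi> i (f s $ i)) \<in> borel_measurable M" for i
    using superlinear_strictly_convex.measurable_integrand[OF \<psi>]
      borel_measurable_integrable[OF integrable_vec_nth[OF f]] by measurable
  have "integral_functional M \<phi> (L1_class M f) =
      ereal_integral M (\<lambda>s. enn2ereal (\<Sum>i\<in>UNIV. \<psi> i (f s $ i)) - ereal (\<Sum>i\<in>UNIV. c i))"
    unfolding integral_functional_class[OF f] \<phi> by (simp add: sum)
  also have "\<dots> = enn2ereal (\<integral>\<^sup>+ s. (\<Sum>i\<in>UNIV. \<psi> i (f s $ i)) \<partial>M) - ereal ((\<Sum>i\<in>UNIV. c i) * measure M (space M))"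
    using meas c by (intro ereal_integral_shift assms(1)) (auto intro: sum_nonneg)
  also have "(\<integral>\<^sup>+ s. (\<Sum>i\<in>UNIV. \<psi> i (f s $ i)) \<partial>M) = separable_integral M \<psi> f"
    using meas by (simp add: nn_integral_sum separable_integral_def)
  finally show ?thesis .
qed


section \<open>Properness, strict convexity, weak compactness and the Kadec property of the integral
  functional\<close>

theorem theorem3p8:
  fixes M :: "'s measure"
    and \<phi>i :: "'d::finite \<Rightarrow> real \<Rightarrow> ereal"
    and \<phi> :: "real ^ 'd \<Rightarrow> ereal"
  assumes "complete_measure M" and "finite_measure M" and "emeasure M (space M) \<noteq> 0"
    and "\<And>i. proper_on UNIV (\<phi>i i)"
    and "\<And>i. lower_semicontinuous (\<phi>i i)"
    and "\<And>i. ereal_convex (\<phi>i i)"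
    and "\<And>i. interior (effective_domain UNIV (\<phi>i i)) \<noteq> {}"
    and "\<And>i. ereal_differentiable (fenchel_conjugate (\<phi>i i))"
    and "\<And>z. \<phi> z = (\<Sum>i\<in>UNIV. \<phi>i i (z $ i))"
  shows "strongly_rotund (L1 M) (integral_functional M \<phi>)"
proof -
  interpret finite_measure M by fact
  have "\<exists>c \<psi>. \<forall>i. 0 \<le> c i \<and> superlinear_strictly_convex (\<psi> i) \<and> (\<forall>t. \<phi>i i t = enn2ereal (\<psi> i t) - ereal (c i))"
    using superlinear_strictly_convex_shift[OF assms(4-6,8)] by metis
  then obtain c \<psi> where c: "\<And>i. 0 \<le> c i" and \<psi>: "\<And>i. superlinear_strictly_convex (\<psi> i)"
      and shift: "\<And>i t. \<phi>i i t = enn2ereal (\<psi> i t) - ereal (c i)" by blast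
  have \<phi>: "\<phi> z = (\<Sum>i\<in>UNIV. enn2ereal (\<psi> i (z $ i)) - ereal (c i))" for z
    using assms(9) shift by simp
  define C where "C = (\<Sum>i\<in>UNIV. c i) * measure M (space M)"
  define J where "J = separable_integral M \<psi>"
  let ?I = "integral_functional M \<phi>"
  have I_class: "?I (L1_class M f) = enn2ereal (J f) - ereal C" if "integrable M f" for f
    unfolding C_def J_def by (rule integral_functional_eq_separable_integral[OF assms(2) \<psi> c \<phi> that])
  have I_rep: "?I x = enn2ereal (J (L1_rep x)) - ereal C" if "x \<in> points (L1 M)" for x
    using I_class[OF L1_class_L1_rep(1)[OF that]] L1_class_L1_rep(2)[OF that] by simp
  have dom: "x \<in> effective_domain (points (L1 M)) ?I \<longleftrightarrow> x \<in> points (L1 M) \<and> J (L1_rep x) < \<infinity>" for x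
  proof (cases "x \<in> points (L1 M)")
    case True
    then show ?thesis unfolding effective_domain_def
      by (cases "J (L1_rep x)") (auto simp: I_rep enn2ereal_ennreal)
  qed (simp add: effective_domain_def)
  have proper: "proper_on (points (L1 M)) ?I"
    unfolding proper_on_def
  proof
    show "\<forall>x\<in>points (L1 M). ?I x \<noteq> - \<infinity>"
    proof
      fix x :: "('s \<Rightarrow> real ^ 'd) set" assume "x \<in> points (L1 M)"
      then show "?I x \<noteq> - \<infinity>" by (cases "J (L1_rep x)") (auto simp: I_rep enn2ereal_ennreal)
    qed
    obtain z where z: "\<And>i. \<psi> i (z i) < \<infinity>"
      using superlinear_strictly_convex.finite_somewhere[OF \<psi>] by metis
    have k: "integrable M (\<lambda>_. vec_lambda z :: real ^ 'd)" by simp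
    have "J (\<lambda>_. vec_lambda z) < \<infinity>"
      unfolding J_def separable_integral_def using z
      by (simp add: ennreal_mult_less_top emeasure_eq_measure)
    then have "J (L1_rep (L1_class M (\<lambda>_. vec_lambda z))) < \<infinity>"
      unfolding J_def separable_integral_cong_AE[OF L1_rep_class(2)[OF k]] .
    then show "effective_domain (points (L1 M)) ?I \<noteq> {}"
      using dom L1_class_in_points[OF k] by blast
  qed
  have strict: "strictly_convex_on_domain (L1 M) ?I"
    unfolding strictly_convex_on_domain_def
  proof (intro ballI allI impI)
    fix x y and t :: real
    assume x: "x \<in> effective_domain (points (L1 M)) ?I" and y: "y \<in> effective_domain (points (L1 M)) ?I"
      and t: "x \<noteq> y \<and> 0 < t \<and> t < 1"
    have xp: "x \<in> points (L1 M)" and yp: "y \<in> points (L1 M)" using x y dom by blast+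
    note rx = L1_class_L1_rep[OF xp] and ry = L1_class_L1_rep[OF yp]
    define m where "m s = (1 - t) *\<^sub>R L1_rep x s + t *\<^sub>R L1_rep y s" for s
    have m: "integrable M m" unfolding m_def[abs_def] using rx(1) ry(1) by simp
    have comb: "vadd (L1 M) (vscale (L1 M) (1 - t) x) (vscale (L1 M) t y) = L1_class M m"
    proof -
      have "vscale (L1 M) (1 - t) x = L1_class M (\<lambda>s. (1 - t) *\<^sub>R L1_rep x s)"
        using L1_scale[OF rx(1), of "1 - t"] rx(2) by simp
      moreover have "vscale (L1 M) t y = L1_class M (\<lambda>s. t *\<^sub>R L1_rep y s)"
        using L1_scale[OF ry(1), of t] ry(2) by simp
      ultimately show ?thesis unfolding m_def[abs_def]
        using L1_add[OF integrable_scaleR_right[OF rx(1), of "1 - t"] integrable_scaleR_right[OF ry(1), of t]]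
        by simp
    qed
    have ne: "\<not> (AE s in M. L1_rep x s = L1_rep y s)"
      using t rx ry L1_class_eq_iff[OF rx(1), of "L1_rep y"] by auto
    have fin: "J (L1_rep x) < \<infinity>" "J (L1_rep y) < \<infinity>" using x y dom by blast+
    have lt: "J m < ennreal (1 - t) * J (L1_rep x) + ennreal t * J (L1_rep y)"
      using separable_integral_strictly_convex[OF \<psi> borel_measurable_integrable[OF rx(1)]
          borel_measurable_integrable[OF ry(1)] _ _ fin[unfolded J_def] ne] t
      unfolding J_def m_def[abs_def] by blast
    obtain a where a: "J (L1_rep x) = ennreal a" "0 \<le> a" using fin(1) by (cases "J (L1_rep x)") auto
    obtain b where b: "J (L1_rep y) = ennreal b" "0 \<le> b" using fin(2) by (cases "J (L1_rep y)") auto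
    have ab: "ennreal (1 - t) * ennreal a + ennreal t * ennreal b = ennreal ((1 - t) * a + t * b)"
      using a b t by (simp add: ennreal_plus ennreal_mult)
    obtain d where d: "J m = ennreal d" "0 \<le> d" using lt unfolding a b ab by (cases "J m") auto
    have "d < (1 - t) * a + t * b" using lt d unfolding a b ab by (simp add: ennreal_less_iff)
    \<comment> \<open>The constant survives the convex combination unchanged because the weights sum
      to 1.\<close>
    then have "ereal (d - C) < ereal ((1 - t) * (a - C) + t * (b - C))" by (simp add: algebra_simps)
    then show "?I (vadd (L1 M) (vscale (L1 M) (1 - t) x) (vscale (L1 M) t y)) <
        ereal (1 - t) * ?I x + ereal t * ?I y"
      unfolding comb I_class[OF m] I_rep[OF xp] I_rep[OF yp] using a b d by (simp add: enn2ereal_ennreal)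
  qed
  have compact: "compactin (weak_topology (L1 M)) {x \<in> points (L1 M). ?I x \<le> ereal r}" for r
  proof -
    \<comment> \<open>The guard on \<open>r + C\<close> is essential: for negative values
      \<open>ennreal\<close> would replace the bound by 0, while the level set is empty.\<close>
    have iff: "?I x \<le> ereal r \<longleftrightarrow> 0 \<le> r + C \<and> J (L1_rep x) \<le> ennreal (r + C)" if "x \<in> points (L1 M)" for x
      by (cases "J (L1_rep x)") (auto simp: I_rep[OF that] enn2ereal_ennreal ennreal_le_iff2 algebra_simps top_unique)
    show ?thesis
    proof (cases "0 \<le> r + C")
      case True
      then have "{x \<in> points (L1 M). ?I x \<le> ereal r} = {x \<in> points (L1 M). J (L1_rep x) \<le> ennreal (r + C)}"
        using iff by auto
      then show ?thesis
        using compactin_separable_integral_level_set[OF assms(2) \<psi> True] by (simp add: J_def)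
    next
      case False
      then have "{x \<in> points (L1 M). ?I x \<le> ereal r} = {}" using iff by auto
      then show ?thesis by (simp only: compactin_empty)
    qed
  qed
  have "kadec (L1 M) ?I"
    unfolding kadec_def
  proof (intro allI ballI impI)
    fix u x assume x: "x \<in> effective_domain (points (L1 M)) ?I"
      and h: "(\<forall>n. u n \<in> points (L1 M)) \<and> limitin (weak_topology (L1 M)) u x sequentially \<and>
        (\<lambda>n. ?I (u n)) \<longlonglongrightarrow> ?I x"
    have xp: "x \<in> points (L1 M)" and fin: "J (L1_rep x) < \<infinity>" using x dom by blast+
    have up: "u n \<in> points (L1 M)" for n using h by blast
    note rx = L1_class_L1_rep[OF xp] and ru = L1_class_L1_rep[OF up]
    have shift: "?I y + ereal C = enn2ereal (J (L1_rep y))" if "y \<in> points (L1 M)" for y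
      unfolding I_rep[OF that] by (cases "J (L1_rep y)") (auto simp: enn2ereal_ennreal)
    \<comment> \<open>Adding the constant back turns the hypothesis into convergence of the
      nonnegative \<open>J\<close>, even if some \<open>?I (u n)\<close> are infinite.\<close>
    have "(\<lambda>n. ?I (u n) + ereal C) \<longlonglongrightarrow> ?I x + ereal C"
      using h proper xp by (intro tendsto_cadd_ereal) (auto simp: proper_on_def)
    then have J_lim: "(\<lambda>n. J (L1_rep (u n))) \<longlonglongrightarrow> J (L1_rep x)"
      unfolding shift[OF up] shift[OF xp] by simp
    have conv: "converges_on_sets M sequentially (\<lambda>n s. L1_rep (u n) s $ i) (\<lambda>s. L1_rep x s $ i)" for i
      unfolding converges_on_sets_def
      using h by (auto intro: limitin_weak_topology_imp_tendsto[OF _ coordinate_integral_in_dual_space])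
    have coord: "(\<lambda>n. \<integral>s. \<bar>L1_rep (u n) s $ i - L1_rep x s $ i\<bar> \<partial>M) \<longlonglongrightarrow> 0" for i
    proof (rule superlinear_strictly_convex.L1_tendsto_if_converges_on_sets[OF \<psi> assms(2)
          integrable_vec_nth[OF ru(1)] integrable_vec_nth[OF rx(1)] conv])
      show "(\<integral>\<^sup>+ s. \<psi> i (L1_rep x s $ i) \<partial>M) < \<infinity>"
        using fin unfolding J_def separable_integral_def by simp
      show "(\<lambda>n. \<integral>\<^sup>+ s. \<psi> i (L1_rep (u n) s $ i) \<partial>M) \<longlonglongrightarrow> (\<integral>\<^sup>+ s. \<psi> i (L1_rep x s $ i) \<partial>M)"
      proof (rule ennreal_tendsto_summands[where I = UNIV and i = i
            and a = "\<lambda>i. \<integral>\<^sup>+ s. \<psi> i (L1_rep x s $ i) \<partial>M"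
            and b = "\<lambda>i n. \<integral>\<^sup>+ s. \<psi> i (L1_rep (u n) s $ i) \<partial>M"])
        show "(\<lambda>n. \<Sum>i\<in>UNIV. \<integral>\<^sup>+ s. \<psi> i (L1_rep (u n) s $ i) \<partial>M)
            \<longlonglongrightarrow> (\<Sum>i\<in>UNIV. \<integral>\<^sup>+ s. \<psi> i (L1_rep x s $ i) \<partial>M)"
          using J_lim by (simp add: J_def separable_integral_def)
        show "(\<Sum>i\<in>UNIV. \<integral>\<^sup>+ s. \<psi> i (L1_rep x s $ i) \<partial>M) < \<infinity>"
          using fin by (simp add: J_def separable_integral_def)
        show "(\<integral>\<^sup>+ s. \<psi> i (L1_rep x s $ i) \<partial>M) \<le> liminf (\<lambda>n. \<integral>\<^sup>+ s. \<psi> i (L1_rep (u n) s $ i) \<partial>M)" for i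
          by (intro superlinear_strictly_convex.nn_integral_le_Liminf[OF \<psi> assms(2)] conv
              always_eventually allI integrable_vec_nth ru(1) rx(1))
      qed simp_all
    qed
    \<comment> \<open>The Euclidean norm is at most the sum of the absolute coordinates, so
      convergence in mean of each coordinate suffices.\<close>
    have norm_le: "vnorm (L1 M) (vadd (L1 M) (u n) (vscale (L1 M) (- 1) x)) \<le>
        (\<Sum>i\<in>UNIV. \<integral>s. \<bar>L1_rep (u n) s $ i - L1_rep x s $ i\<bar> \<partial>M)"
      and norm_nonneg: "0 \<le> vnorm (L1 M) (vadd (L1 M) (u n) (vscale (L1 M) (- 1) x))" for n
    proof -
      have "vscale (L1 M) (- 1) x = L1_class M (\<lambda>s. (- 1) *\<^sub>R L1_rep x s)"
        using L1_scale[OF rx(1), of "- 1"] rx(2) by simp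
      then have "vadd (L1 M) (u n) (vscale (L1 M) (- 1) x) = L1_class M (\<lambda>s. L1_rep (u n) s - L1_rep x s)"
        using L1_add[OF ru(1)[of n] integrable_scaleR_right[OF rx(1), of "- 1"]] ru(2)[of n] by simp
      then have eq: "vnorm (L1 M) (vadd (L1 M) (u n) (vscale (L1 M) (- 1) x)) =
          (\<integral>s. norm (L1_rep (u n) s - L1_rep x s) \<partial>M)"
        using L1_norm[OF Bochner_Integration.integrable_diff[OF ru(1)[of n] rx(1)]] by simp
      show "0 \<le> vnorm (L1 M) (vadd (L1 M) (u n) (vscale (L1 M) (- 1) x))" unfolding eq by simp
      have int: "integrable M (\<lambda>s. \<bar>L1_rep (u n) s $ i - L1_rep x s $ i\<bar>)" for i
        using integrable_vec_nth[OF ru(1)[of n], of i] integrable_vec_nth[OF rx(1), of i] by simp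
      have "(\<integral>s. norm (L1_rep (u n) s - L1_rep x s) \<partial>M) \<le>
          (\<integral>s. (\<Sum>i\<in>UNIV. \<bar>L1_rep (u n) s $ i - L1_rep x s $ i\<bar>) \<partial>M)"
        using ru(1)[of n] rx(1) int norm_le_l1_cart[of "L1_rep (u n) _ - L1_rep x _"]
        by (intro integral_mono) auto
      also have "\<dots> = (\<Sum>i\<in>UNIV. \<integral>s. \<bar>L1_rep (u n) s $ i - L1_rep x s $ i\<bar> \<partial>M)"
        using int by simp
      finally show "vnorm (L1 M) (vadd (L1 M) (u n) (vscale (L1 M) (- 1) x)) \<le>
          (\<Sum>i\<in>UNIV. \<integral>s. \<bar>L1_rep (u n) s $ i - L1_rep x s $ i\<bar> \<partial>M)" unfolding eq .
    qed
    have lim: "(\<lambda>n. \<Sum>i\<in>UNIV. \<integral>s. \<bar>L1_rep (u n) s $ i - L1_rep x s $ i\<bar> \<partial>M) \<longlonglongrightarrow> 0"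
      using tendsto_sum[of UNIV, OF coord] by simp
    show "norm_converges (L1 M) u x"
      unfolding norm_converges_def
    proof (rule tendsto_sandwich[OF _ _ tendsto_const lim])
      show "\<forall>\<^sub>F n in sequentially. 0 \<le> vnorm (L1 M) (vadd (L1 M) (u n) (vscale (L1 M) (- 1) x))"
        by (intro always_eventually allI norm_nonneg)
      show "\<forall>\<^sub>F n in sequentially. vnorm (L1 M) (vadd (L1 M) (u n) (vscale (L1 M) (- 1) x)) \<le>
          (\<Sum>i\<in>UNIV. \<integral>s. \<bar>L1_rep (u n) s $ i - L1_rep x s $ i\<bar> \<partial>M)"
        by (intro always_eventually allI norm_le)
    qed
  qed
  with proper strict compact show ?thesis by (simp add: strongly_rotund_def)
qed

end
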